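(* Let $(x_{i,j},y_{i,j})$ ($i=1,\dots,m$, $j=1,\dots,n$) be i.i.d. samples from $\mathcal X\times\mathcal Y$, with $\mathcal X\subset\mathbb R^d$, $\mathcal Y\subset\mathbb R$, $\|x\|_2\le B_x$ and $|y|\le B_y$ for all $(x,y)\in\mathcal X\times\mathcal Y$. Let $\lambda>0$, $f_i(w)=\frac1n\sum_{j=1}^n(y_{i,j}-w^Tx_{i,j})^2+\frac\lambda2\|w\|_2^2$ and $$f(w)=\frac1m\sum_{i=1}^mf_i(w)=\frac1{mn}\sum_{i=1}^m\sum_{j=1}^n(y_{i,j}-w^Tx_{i,j})^2+\frac\lambda2\|w\|_2^2 .$$ Let $L=\lambda+2B_x^2$ and $\delta\in(0,1)$. Suppose DiSCO (see context) is applied to minimize $f$ with input parameter $$\mu=\sqrt{\frac{32L^2d}{n}}\sqrt{\frac{\log(md/\delta)}{d}},$$ and let $T$ be the total number of communication rounds required to find an $\epsilon$-optimal solution, i.e. $\widehat w$ with $f(\widehat w)-\min f\le\epsilon$. Then with probability at least $1-\delta$, $$T=\widetilde{\mathcal O}\left(\Bigl(1+\frac{B_x}{\lambda^{1/2}n^{1/4}}\Bigr)\log(1/\epsilon)\log(md/\delta)\right).$$ Here the initial gap $f(w_0)-\min f$ is regarded as a constant (for example $w_0=0$, for which it is at most $B_y^2$), and $\widetilde{\mathcal O}$ hides universal constants, this constant, and factors logarithmic in $L/\lambda$.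
   Context: Setting: there are $m$ machines; machine $i$ holds $f_i$; machine 1 is the master. In one round of communication the master broadcasts a message of $O(d)$ size to all machines and aggregates (sums or averages) messages of $O(d)$ size returned by the machines. DiSCO with parameter $\mu$: an initial point $w_0$ is obtained with at most one round (by default $w_0=\frac1m\sum_i\arg\min_w\{f_i(w)+\frac\rho2\|w\|_2^2\}$ for an input $\rho\ge0$; $w_0=0$ is also allowed here). For $k=0,1,2,\dots$: compute $v_k$ by distributed PCG at $w_k$ (below), set $\delta_k=\sqrt{v_k^Tf''(w_k)v_k}$ and $w_{k+1}=w_k-\frac1{1+\delta_k}v_k$. Distributed PCG at $w_k$: let $H=f''(w_k)$, $P=f_1''(w_k)+\mu I$, $\epsilon_k=\beta(\lambda/L)^{1/2}\|f'(w_k)\|_2$ with $\beta=1/20$. One round forms $f'(w_k)$. Set $v^{(0)}=0$, $r^{(0)}=f'(w_k)$, $s^{(0)}=P^{-1}r^{(0)}$, $u^{(0)}=s^{(0)}$ (if $f'(w_k)=0$, return $v_k=0$). For $t=0,1,\dots$, each iteration using one round (to form $Hu^{(t)},Hv^{(t)}$): $\alpha_t=\frac{\langle r^{(t)},s^{(t)}\rangle}{\langle u^{(t)},Hu^{(t)}\rangle}$, $v^{(t+1)}=v^{(t)}+\alpha_tu^{(t)}$, $r^{(t+1)}=r^{(t)}-\alpha_tHu^{(t)}$, $s^{(t+1)}=P^{-1}r^{(t+1)}$, $\beta_t=\frac{\langle r^{(t+1)},s^{(t+1)}\rangle}{\langle r^{(t)},s^{(t)}\rangle}$, $u^{(t+1)}=s^{(t+1)}+\beta_tu^{(t)}$;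 stop as soon as $\|r^{(t+1)}\|_2\le\epsilon_k$ and return $v_k=v^{(t+1)}$. $T$ counts all rounds used until the first iterate $\widehat w=w_k$ with the required accuracy is available. *)

theory Defs
  imports
    "HOL-Probability.Probability"
    "Jordan_Normal_Form.Gauss_Jordan_Elimination"
begin

unbundle no inner_syntax
no_notation vec_nth (infixl \<open>$\<close> 90)
hide_type (open) Finite_Cartesian_Product.vec
hide_const (open) Finite_Cartesian_Product.vec

text \<open>
  Vectors of \<open>\<real>\<^sup>d\<close> are elements of \<^term>\<open>carrier_vec d :: real vec set\<close>, so that the dimension
  is an ordinary natural number and constants can be required not to depend on it.
\<close>

definition norm2 :: "real vec \<Rightarrow> real" where
  "norm2 v = sqrt (v \<bullet> v)"

definition grad :: "nat \<Rightarrow> (real vec \<Rightarrow> real) \<Rightarrow> real vec \<Rightarrow> real vec" where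
  "grad d f w = vec d (\<lambda>k. deriv (\<lambda>t. f (w + t \<cdot>\<^sub>v unit_vec d k)) 0)"

definition hess :: "nat \<Rightarrow> (real vec \<Rightarrow> real) \<Rightarrow> real vec \<Rightarrow> real mat" where
  "hess d f w = mat d d (\<lambda>(k, l). deriv (\<lambda>t. grad d f (w + t \<cdot>\<^sub>v unit_vec d l) $ k) 0)"

definition subopt :: "nat \<Rightarrow> (real vec \<Rightarrow> real) \<Rightarrow> real vec \<Rightarrow> real" where
  "subopt d f w = f w - (INF u\<in>carrier_vec d. f u)"

definition first_index :: "(nat \<Rightarrow> bool) \<Rightarrow> enat" where
  "first_index P = (INF k\<in>{k. P k}. enat k)" \<comment> \<open>\<open>\<infinity>\<close> if \<open>P\<close> never holds\<close>


section \<open>Preconditioned conjugate gradient\<close>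

type_synonym pcg_state = "real vec \<times> real vec \<times> real vec \<times> real vec" \<comment> \<open>\<open>(v, r, s, u)\<close>\<close>

definition pcg_step :: "real mat \<Rightarrow> real mat \<Rightarrow> pcg_state \<Rightarrow> pcg_state" where
  "pcg_step H P = (\<lambda>(v, r, s, u).
     let \<alpha> = (r \<bullet> s) / (u \<bullet> (H *\<^sub>v u));
         v' = v + \<alpha> \<cdot>\<^sub>v u;
         r' = r - \<alpha> \<cdot>\<^sub>v (H *\<^sub>v u);
         s' = the (mat_inverse P) *\<^sub>v r';
         \<beta> = (r' \<bullet> s') / (r \<bullet> s)
     in (v', r', s', s' + \<beta> \<cdot>\<^sub>v u))"

primrec pcg :: "nat \<Rightarrow> real mat \<Rightarrow> real mat \<Rightarrow> real vec \<Rightarrow> nat \<Rightarrow> pcg_state" where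
  "pcg d H P g 0 =
     (let s = the (mat_inverse P) *\<^sub>v g in (0\<^sub>v d, g, s, s))"
| "pcg d H P g (Suc t) = pcg_step H P (pcg d H P g t)"

definition pcg_residual :: "nat \<Rightarrow> real mat \<Rightarrow> real mat \<Rightarrow> real vec \<Rightarrow> nat \<Rightarrow> real vec" where
  "pcg_residual d H P g t = fst (snd (pcg d H P g t))"

text \<open>
  The residual is tested only after at least one iteration, except that nothing is done for \<open>g = 0\<close>.
  The count is \<open>\<infinity>\<close> if the stopping test never succeeds; the returned vector is then unspecified.
\<close>

definition pcg_iterations :: "nat \<Rightarrow> real mat \<Rightarrow> real mat \<Rightarrow> real vec \<Rightarrow> real \<Rightarrow> enat" where
  "pcg_iterations d H P g \<epsilon> =
     (if g = 0\<^sub>v d then 0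
      else first_index (\<lambda>t. 1 \<le> t \<and> norm2 (pcg_residual d H P g t) \<le> \<epsilon>))"

definition pcg_result :: "nat \<Rightarrow> real mat \<Rightarrow> real mat \<Rightarrow> real vec \<Rightarrow> real \<Rightarrow> real vec" where
  "pcg_result d H P g \<epsilon> = fst (pcg d H P g (the_enat (pcg_iterations d H P g \<epsilon>)))"


section \<open>DiSCO\<close>

definition average :: "nat \<Rightarrow> (nat \<Rightarrow> real vec \<Rightarrow> real) \<Rightarrow> real vec \<Rightarrow> real" where
  "average m fs w = (\<Sum>i=1..m. fs i w) / real m"

definition newton_precond :: "nat \<Rightarrow> (nat \<Rightarrow> real vec \<Rightarrow> real) \<Rightarrow> real \<Rightarrow> real vec \<Rightarrow> real mat" where
  "newton_precond d fs \<mu> w = hess d (fs 1) w + \<mu> \<cdot>\<^sub>m 1\<^sub>m d"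

definition newton_tol :: "nat \<Rightarrow> (real vec \<Rightarrow> real) \<Rightarrow> real \<Rightarrow> real \<Rightarrow> real vec \<Rightarrow> real" where
  "newton_tol d f lam L w = 1 / 20 * sqrt (lam / L) * norm2 (grad d f w)"

definition newton_pcg_iterations ::
  "nat \<Rightarrow> nat \<Rightarrow> (nat \<Rightarrow> real vec \<Rightarrow> real) \<Rightarrow> real \<Rightarrow> real \<Rightarrow> real \<Rightarrow> real vec \<Rightarrow> enat" where
  "newton_pcg_iterations d m fs lam L \<mu> w =
     (let f = average m fs
      in pcg_iterations d (hess d f w) (newton_precond d fs \<mu> w) (grad d f w) (newton_tol d f lam L w))"

definition newton_direction ::
  "nat \<Rightarrow> nat \<Rightarrow> (nat \<Rightarrow> real vec \<Rightarrow> real) \<Rightarrow> real \<Rightarrow> real \<Rightarrow> real \<Rightarrow> real vec \<Rightarrow> real vec" where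
  "newton_direction d m fs lam L \<mu> w =
     (let f = average m fs
      in pcg_result d (hess d f w) (newton_precond d fs \<mu> w) (grad d f w) (newton_tol d f lam L w))"

definition disco_step ::
  "nat \<Rightarrow> nat \<Rightarrow> (nat \<Rightarrow> real vec \<Rightarrow> real) \<Rightarrow> real \<Rightarrow> real \<Rightarrow> real \<Rightarrow> real vec \<Rightarrow> real vec" where
  "disco_step d m fs lam L \<mu> w =
     (let v = newton_direction d m fs lam L \<mu> w;
          \<delta> = sqrt (v \<bullet> (hess d (average m fs) w *\<^sub>v v))
      in w - (1 / (1 + \<delta>)) \<cdot>\<^sub>v v)"

datatype disco_init = Zero_Init | Averaged_Init real \<comment> \<open>the argument is \<open>\<rho>\<close>\<close>

fun valid_init :: "disco_init \<Rightarrow> bool" where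
  "valid_init Zero_Init \<longleftrightarrow> True"
| "valid_init (Averaged_Init \<rho>) \<longleftrightarrow> 0 \<le> \<rho>"

fun init_point :: "nat \<Rightarrow> nat \<Rightarrow> (nat \<Rightarrow> real vec \<Rightarrow> real) \<Rightarrow> disco_init \<Rightarrow> real vec" where
  "init_point d m fs Zero_Init = 0\<^sub>v d"
| "init_point d m fs (Averaged_Init \<rho>) =
     vec d (\<lambda>k. (\<Sum>i=1..m. arg_min_on (\<lambda>w. fs i w + \<rho> / 2 * (norm2 w)\<^sup>2) (carrier_vec d) $ k) / real m)"

fun init_rounds :: "disco_init \<Rightarrow> nat" where
  "init_rounds Zero_Init = 0"
| "init_rounds (Averaged_Init \<rho>) = 1"

definition disco_iterate ::
  "nat \<Rightarrow> nat \<Rightarrow> (nat \<Rightarrow> real vec \<Rightarrow> real) \<Rightarrow> real \<Rightarrow> real \<Rightarrow> real \<Rightarrow> disco_init \<Rightarrow> nat \<Rightarrow> real vec" where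
  "disco_iterate d m fs lam L \<mu> ini k = (disco_step d m fs lam L \<mu> ^^ k) (init_point d m fs ini)"

text \<open>
  Every outer iteration costs one round for the gradient and one round per PCG iteration.
  The total is \<open>\<infinity>\<close> if no iterate is \<open>\<epsilon>\<close>-optimal or if a PCG run before the first such iterate diverges.
\<close>

definition disco_rounds ::
  "nat \<Rightarrow> nat \<Rightarrow> (nat \<Rightarrow> real vec \<Rightarrow> real) \<Rightarrow> real \<Rightarrow> real \<Rightarrow> real \<Rightarrow> disco_init \<Rightarrow> real \<Rightarrow> enat" where
  "disco_rounds d m fs lam L \<mu> ini \<epsilon> =
     (let w = disco_iterate d m fs lam L \<mu> ini
      in case first_index (\<lambda>k. subopt d (average m fs) (w k) \<le> \<epsilon>) of
           enat K \<Rightarrow> enat (init_rounds ini) + (\<Sum>k<K. 1 + newton_pcg_iterations d m fs lam L \<mu> (w k))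
         | \<infinity> \<Rightarrow> \<infinity>)"


section \<open>Ridge regression on i.i.d. samples\<close>

text \<open>
  A labelled point \<open>(x, y)\<close> of \<open>\<real>\<^sup>d \<times> \<real>\<close> is drawn as a pair whose first component is a coordinate
  function on \<^term>\<open>{..<d}\<close>, which makes the product \<open>\<sigma>\<close>-algebra available; \<open>feature d\<close>
  turns it into a vector.
\<close>

type_synonym labelled = "(nat \<Rightarrow> real) \<times> real"

definition labelled_space :: "nat \<Rightarrow> labelled measure" where
  "labelled_space d = (\<Pi>\<^sub>M k\<in>{..<d}. borel) \<Otimes>\<^sub>M borel"

definition feature :: "nat \<Rightarrow> labelled \<Rightarrow> real vec" where
  "feature d z = vec d (fst z)"

definition label :: "labelled \<Rightarrow> real" where
  "label z = snd z"

text \<open>The joint law of the samples \<open>(i, j)\<close>, drawn independently from \<open>D\<close>.\<close>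

definition iid_samples :: "nat \<Rightarrow> nat \<Rightarrow> labelled measure \<Rightarrow> (nat \<times> nat \<Rightarrow> labelled) measure" where
  "iid_samples m n D = (\<Pi>\<^sub>M p\<in>{1..m} \<times> {1..n}. D)"

definition ridge_loss ::
  "nat \<Rightarrow> nat \<Rightarrow> real \<Rightarrow> (nat \<times> nat \<Rightarrow> labelled) \<Rightarrow> nat \<Rightarrow> real vec \<Rightarrow> real" where
  "ridge_loss d n lam z i w =
     (\<Sum>j=1..n. (label (z (i, j)) - w \<bullet> feature d (z (i, j)))\<^sup>2) / real n + lam / 2 * (norm2 w)\<^sup>2"

definition ln1 :: "real \<Rightarrow> real" where
  "ln1 x = max 1 (ln x)" \<comment> \<open>a logarithm inside \<open>O\<close>-notation, kept away from zero\<close>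

end

(*
  For least squares all Hessians are constant, so DiSCO is analysed in the H-norm, H being the
  Hessian of f. If H <= P <= k H, preconditioned CG halves the energy of the error every 2 sqrt k
  steps: since the preconditioned residuals are P-orthogonal, the energies of later steps add up to
  at most sqrt k times the current one. The stopping rule makes every Newton direction exact up to a
  factor 1/20, and the damped step then contracts the H-distance to the minimizer by a factor
  depending only on the initial gap.

  On the event |H_1 - H| <= mu in Frobenius norm one has k = 1 + 2 mu / lambda. No matrix Chernoff
  bound is needed: H_1 - H is a combination, with coefficients summing to zero, of i.i.d. bounded
  random vectors in d^2-dimensional Euclidean space, and iterating Hoeffding's lemma bounds the
  exponential moment of its squared norm.
*)
theory Submission
  imports Defs "Jordan_Normal_Form.Determinant" "HOL-Probability.Hoeffding"
begin

section \<open>Positive definite forms\<close>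

text \<open>The master Hessian is compared with the empirical Hessian of all samples rather than
  with a population Hessian, so a single matrix difference has to be controlled. The Frobenius norm
  is affordable because the two factors \<open>d\<close> in \<mu> cancel: \<mu>^2 = 32 L^2
  ln(md/\<delta>) / n. The vectors 2 x x^T have norm at most L, centering doubles this bound, and
  the squared weights add up to at most 1/n. The variance proxy is therefore \<sigma> = 4 L^2 / n,
  and 32 = 8 * 4 matches the tail exp(1/6 - t / (8 \<sigma>)). All randomness sits in one event,
  which up to a null set depends on the features alone; on it the round count is bounded for every
  accuracy and either initialization. A further obstacle is degeneracy: the PCG quotients become 0/0
  once a residual vanishes. The orthogonality and energy statements are therefore relative to
  nonzero earlier residuals, and a vanishing residual is treated as early success.\<close>

lemma scalar_prod_add_diff:
  fixes u v w :: "real vec"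
  assumes "u \<in> carrier_vec d" "v \<in> carrier_vec d" "w \<in> carrier_vec d"
  shows "(u + v) \<bullet> w = u \<bullet> w + v \<bullet> w" "w \<bullet> (u + v) = w \<bullet> u + w \<bullet> v"
    "(u - v) \<bullet> w = u \<bullet> w - v \<bullet> w" "w \<bullet> (u - v) = w \<bullet> u - w \<bullet> v"
  using assms
  by (auto simp: add_scalar_prod_distrib[where n=d] scalar_prod_add_distrib[where n=d]
      minus_scalar_prod_distrib[where n=d] scalar_prod_minus_distrib[where n=d])

lemma scalar_prod_scale:
  fixes u w :: "real vec"
  assumes "u \<in> carrier_vec d" "w \<in> carrier_vec d"
  shows "(c \<cdot>\<^sub>v u) \<bullet> w = c * (u \<bullet> w)" "w \<bullet> (c \<cdot>\<^sub>v u) = c * (w \<bullet> u)"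
  using assms by auto

lemmas scalar_prod_vec_simps = scalar_prod_add_diff scalar_prod_scale

lemma mult_mat_vec_add_diff:
  fixes A :: "real mat"
  assumes "A \<in> carrier_mat d d" "u \<in> carrier_vec d" "v \<in> carrier_vec d"
  shows "A *\<^sub>v (u + v) = A *\<^sub>v u + A *\<^sub>v v" "A *\<^sub>v (u - v) = A *\<^sub>v u - A *\<^sub>v v"
  using assms by (auto simp: mult_add_distrib_mat_vec mult_minus_distrib_mat_vec)

lemma mult_mat_vec_zero: "(A :: real mat) \<in> carrier_mat d d \<Longrightarrow> A *\<^sub>v 0\<^sub>v d = 0\<^sub>v d"
  by (intro eq_vecI) auto

lemmas mult_mat_vec_simps = mult_mat_vec_add_diff mult_mat_vec mult_mat_vec_zero

lemma minus_add_eq_vec: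
  "a \<in> carrier_vec d \<Longrightarrow> b \<in> carrier_vec d \<Longrightarrow> c \<in> carrier_vec d \<Longrightarrow> a - (b + c) = a - b - (c :: real vec)"
  by (intro eq_vecI) auto

lemma add_minus_eq_vec:
  "a \<in> carrier_vec d \<Longrightarrow> b \<in> carrier_vec d \<Longrightarrow> (a + b) - b = (a :: real vec)"
  by (intro eq_vecI) auto

lemma scalar_prod_self_nonneg: "0 \<le> (v :: real vec) \<bullet> v"
  by (simp add: scalar_prod_def sum_nonneg)

lemma norm2_nonneg: "0 \<le> norm2 v"
  by (simp add: norm2_def scalar_prod_self_nonneg)

lemma norm2_squared: "(norm2 v)\<^sup>2 = v \<bullet> v"
  by (simp add: norm2_def scalar_prod_self_nonneg)

lemma scalar_prod_self_pos:
  fixes v :: "real vec"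
  assumes "v \<in> carrier_vec d" "v \<noteq> 0\<^sub>v d"
  shows "0 < v \<bullet> v"
proof -
  obtain i where "i < d" "v $ i \<noteq> 0"
    using assms by (metis carrier_vecD eq_vecI index_zero_vec)
  then have "0 < v $ i * v $ i" "i \<in> {0..<dim_vec v}"
    using assms by (auto simp: zero_less_mult_iff)
  then show ?thesis
    unfolding scalar_prod_def by (intro sum_pos2[of _ i]) auto
qed

locale spd_matrix =
  fixes d :: nat and A :: "real mat"
  assumes carrier: "A \<in> carrier_mat d d"
    and sym: "\<And>u v. u \<in> carrier_vec d \<Longrightarrow> v \<in> carrier_vec d \<Longrightarrow> u \<bullet> (A *\<^sub>v v) = v \<bullet> (A *\<^sub>v u)"
    and pos: "\<And>v. v \<in> carrier_vec d \<Longrightarrow> v \<noteq> 0\<^sub>v d \<Longrightarrow> 0 < v \<bullet> (A *\<^sub>v v)"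
begin

lemma closed [simp]: "v \<in> carrier_vec d \<Longrightarrow> A *\<^sub>v v \<in> carrier_vec d"
  using carrier by simp

lemma form_zero_iff: "v \<in> carrier_vec d \<Longrightarrow> v \<bullet> (A *\<^sub>v v) = 0 \<longleftrightarrow> v = 0\<^sub>v d"
  using pos[of v] closed[of v] by (cases "v = 0\<^sub>v d") auto

lemma form_nonneg: "v \<in> carrier_vec d \<Longrightarrow> 0 \<le> v \<bullet> (A *\<^sub>v v)"
  using pos[of v] form_zero_iff[of v] by (cases "v = 0\<^sub>v d") auto

lemma cauchy_schwarz:
  assumes u: "u \<in> carrier_vec d" and v: "v \<in> carrier_vec d"
  shows "(u \<bullet> (A *\<^sub>v v))\<^sup>2 \<le> (u \<bullet> (A *\<^sub>v u)) * (v \<bullet> (A *\<^sub>v v))"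
proof (cases "v = 0\<^sub>v d")
  case True
  have "u \<bullet> (A *\<^sub>v v) = v \<bullet> (A *\<^sub>v u)" using u v by (rule sym)
  then show ?thesis using True u by simp
next
  case False
  define b c where "b = u \<bullet> (A *\<^sub>v v)" and "c = v \<bullet> (A *\<^sub>v v)"
  have c: "0 < c" unfolding c_def by (rule pos[OF v False])
  have "0 \<le> (u - (b / c) \<cdot>\<^sub>v v) \<bullet> (A *\<^sub>v (u - (b / c) \<cdot>\<^sub>v v))"
    using u v by (intro form_nonneg) auto
  also have "\<dots> = u \<bullet> (A *\<^sub>v u) - 2 * (b / c) * b + (b / c)\<^sup>2 * c"
    using u v sym[OF v u]
    by (simp add: scalar_prod_vec_simps[where d=d] mult_mat_vec_simps[OF carrier] b_def c_def
        power2_eq_square algebra_simps)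
  also have "\<dots> = u \<bullet> (A *\<^sub>v u) - b\<^sup>2 / c"
    using c by (simp add: power2_eq_square field_simps)
  finally show ?thesis
    using c unfolding b_def c_def by (simp add: field_simps)
qed

text \<open>A positive form has trivial kernel, so the determinant is nonzero and
  \<open>the (mat_inverse P)\<close> in \<open>pcg\<close> is a genuine inverse rather than an
  unspecified matrix.\<close>

lemma mat_inverse_mult:
  assumes v: "v \<in> carrier_vec d"
  shows "the (mat_inverse A) *\<^sub>v v \<in> carrier_vec d" "A *\<^sub>v (the (mat_inverse A) *\<^sub>v v) = v"
proof -
  have "Determinant.det A \<noteq> 0"
    unfolding det_0_iff_vec_prod_zero_field[OF carrier] using form_zero_iff by force
  then have "A \<in> Units (ring_mat TYPE(real) d (0::nat))"
    by (rule det_non_zero_imp_unit[OF carrier])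
  then obtain B where "mat_inverse A = Some B"
    using mat_inverse(1)[OF carrier, where b="0::nat"] by (cases "mat_inverse A") auto
  with mat_inverse(2)[OF carrier this]
  have B: "A * B = 1\<^sub>m d" "B \<in> carrier_mat d d" "the (mat_inverse A) = B" by auto
  then show "the (mat_inverse A) *\<^sub>v v \<in> carrier_vec d" using v by simp
  have "A *\<^sub>v (B *\<^sub>v v) = (A * B) *\<^sub>v v"
    by (rule assoc_mult_mat_vec[OF carrier B(2) v, symmetric])
  then show "A *\<^sub>v (the (mat_inverse A) *\<^sub>v v) = v" using B v by simp
qed

end

text \<open>Interpreting this instance specializes \<open>cauchy_schwarz\<close> to the Euclidean
  inequality.\<close>

lemma spd_one: "spd_matrix d (1\<^sub>m d)"
  by unfold_locales (auto simp: comm_scalar_prod[where n=d] scalar_prod_self_pos)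

section \<open>Spectral bounds and the size of images\<close>

locale spd_bounded = spd_matrix +
  fixes l L :: real
  assumes l_pos: "0 < l"
    and lower: "\<And>v. v \<in> carrier_vec d \<Longrightarrow> l * (v \<bullet> v) \<le> v \<bullet> (A *\<^sub>v v)"
    and upper: "\<And>v. v \<in> carrier_vec d \<Longrightarrow> v \<bullet> (A *\<^sub>v v) \<le> L * (v \<bullet> v)"
begin

text \<open>In operator terms A^2 <= L A: Cauchy-Schwarz for the form of A is applied to A v and v,
  and one factor |A v|^2 cancels.\<close>

lemma image_upper:
  assumes v: "v \<in> carrier_vec d"
  shows "(A *\<^sub>v v) \<bullet> (A *\<^sub>v v) \<le> L * (v \<bullet> (A *\<^sub>v v))"
proof -
  let ?w = "A *\<^sub>v v"
  have w: "?w \<in> carrier_vec d" using v by simp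
  have "(?w \<bullet> ?w)\<^sup>2 \<le> (?w \<bullet> (A *\<^sub>v ?w)) * (v \<bullet> ?w)"
    using cauchy_schwarz[OF w v] .
  also have "\<dots> \<le> (L * (?w \<bullet> ?w)) * (v \<bullet> ?w)"
    by (intro mult_right_mono upper w form_nonneg v)
  finally have *: "(?w \<bullet> ?w) * (?w \<bullet> ?w) \<le> (?w \<bullet> ?w) * (L * (v \<bullet> ?w))"
    by (simp add: power2_eq_square algebra_simps)
  show ?thesis
  proof (cases "?w = 0\<^sub>v d")
    case True then show ?thesis using v by simp
  next
    case False
    then show ?thesis using * scalar_prod_self_pos[OF w] by simp
  qed
qed

text \<open>The dual bound l A <= A^2: Euclidean Cauchy-Schwarz for v and A v, after which one
  factor of the form cancels.\<close>

lemma image_lower: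
  assumes v: "v \<in> carrier_vec d"
  shows "l * (v \<bullet> (A *\<^sub>v v)) \<le> (A *\<^sub>v v) \<bullet> (A *\<^sub>v v)"
proof -
  interpret I: spd_matrix d "1\<^sub>m d" by (rule spd_one)
  let ?w = "A *\<^sub>v v"
  have w: "?w \<in> carrier_vec d" using v by simp
  have "(v \<bullet> ?w)\<^sup>2 \<le> (v \<bullet> v) * (?w \<bullet> ?w)"
    using I.cauchy_schwarz[OF v w] v w by simp
  then have "l * (v \<bullet> ?w)\<^sup>2 \<le> l * (v \<bullet> v) * (?w \<bullet> ?w)"
    using l_pos by simp
  also have "\<dots> \<le> (v \<bullet> ?w) * (?w \<bullet> ?w)"
    by (intro mult_right_mono lower v scalar_prod_self_nonneg)
  finally have *: "(v \<bullet> ?w) * (l * (v \<bullet> ?w)) \<le> (v \<bullet> ?w) * (?w \<bullet> ?w)"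
    by (simp add: power2_eq_square algebra_simps)
  show ?thesis
  proof (cases "v = 0\<^sub>v d")
    case True then show ?thesis using v scalar_prod_self_nonneg[of ?w] carrier by simp
  next
    case False
    then show ?thesis using * pos[OF v] by simp
  qed
qed

end

section \<open>Convergence of preconditioned conjugate gradients\<close>

text \<open>The exact solution \<open>x\<close> of H x = g is a parameter, so that the error x - v t
  and its energy can be written directly.\<close>

locale pcg_run = H: spd_bounded d H l L + P: spd_matrix d P
  for d :: nat and H :: "real mat" and l L :: real and P :: "real mat" +
  fixes \<kappa> :: real and g x :: "real vec"
  assumes H_le_P: "\<And>v. v \<in> carrier_vec d \<Longrightarrow> v \<bullet> (H *\<^sub>v v) \<le> v \<bullet> (P *\<^sub>v v)"
    and P_le_H: "\<And>v. v \<in> carrier_vec d \<Longrightarrow> v \<bullet> (P *\<^sub>v v) \<le> \<kappa> * (v \<bullet> (H *\<^sub>v v))"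
    and x [simp]: "x \<in> carrier_vec d"
    and g: "g = H *\<^sub>v x"
begin

section \<open>Algebra of the iterates\<close>

definition v where "v t = fst (pcg d H P g t)"
definition r where "r t = fst (snd (pcg d H P g t))"
definition s where "s t = fst (snd (snd (pcg d H P g t)))"
definition u where "u t = snd (snd (snd (pcg d H P g t)))"
definition \<alpha> where "\<alpha> t = (r t \<bullet> s t) / (u t \<bullet> (H *\<^sub>v u t))"
definition \<beta> where "\<beta> t = (r (Suc t) \<bullet> s (Suc t)) / (r t \<bullet> s t)"
definition \<rho> where "\<rho> t = r t \<bullet> s t"
definition energy where "energy t = (x - v t) \<bullet> (H *\<^sub>v (x - v t))"

lemma step_0: "v 0 = 0\<^sub>v d" "r 0 = g" "s 0 = the (mat_inverse P) *\<^sub>v g" "u 0 = s 0"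
  by (simp_all add: v_def r_def s_def u_def Let_def)

lemma step_Suc:
  "v (Suc t) = v t + \<alpha> t \<cdot>\<^sub>v u t"
  "r (Suc t) = r t - \<alpha> t \<cdot>\<^sub>v (H *\<^sub>v u t)"
  "s (Suc t) = the (mat_inverse P) *\<^sub>v r (Suc t)"
  "u (Suc t) = s (Suc t) + \<beta> t \<cdot>\<^sub>v u t"
  by (simp_all add: v_def r_def s_def u_def \<alpha>_def \<beta>_def pcg_step_def Let_def split: prod.splits)

lemma g_closed: "g \<in> carrier_vec d"
  by (simp add: g)

lemma closed [simp]:
  "v t \<in> carrier_vec d" "r t \<in> carrier_vec d" "s t \<in> carrier_vec d" "u t \<in> carrier_vec d"
proof (induction t)
  case 0
  { case 1 show ?case by (simp add: step_0) }
  { case 2 show ?case by (simp add: step_0 g_closed) }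
  { case 3 show ?case by (simp add: step_0 g_closed P.mat_inverse_mult) }
  { case 4 show ?case by (simp add: step_0 g_closed P.mat_inverse_mult) }
next
  case (Suc t)
  have r: "r (Suc t) \<in> carrier_vec d" using Suc by (simp add: step_Suc)
  then have s: "s (Suc t) \<in> carrier_vec d" by (simp add: step_Suc(3) P.mat_inverse_mult)
  { case 1 show ?case using Suc by (simp add: step_Suc) }
  { case 2 show ?case by (rule r) }
  { case 3 show ?case by (rule s) }
  { case 4 show ?case using Suc s by (simp add: step_Suc(4)) }
qed

lemma P_s: "P *\<^sub>v s t = r t"
  by (cases t) (simp_all add: step_0 step_Suc(3) P.mat_inverse_mult g_closed)

lemmas ip = scalar_prod_vec_simps[where d=d] mult_mat_vec_simps[OF H.carrier]
  mult_mat_vec_simps[OF P.carrier]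

lemma error_0: "x - v 0 = x"
  using x by (auto simp: step_0)

lemma residual: "r t = H *\<^sub>v (x - v t)"
proof (induction t)
  case 0
  show ?case by (simp only: step_0(2) error_0) (rule g)
next
  case (Suc t)
  have "H *\<^sub>v (x - v (Suc t)) = H *\<^sub>v ((x - v t) - \<alpha> t \<cdot>\<^sub>v u t)"
    unfolding step_Suc by (subst minus_add_eq_vec[where d=d]) simp_all
  also have "\<dots> = H *\<^sub>v (x - v t) - \<alpha> t \<cdot>\<^sub>v (H *\<^sub>v u t)"
    by (subst ip(8)) (simp_all add: ip(9))
  finally show ?case using Suc by (simp add: step_Suc)
qed

text \<open>Self-adjointness of the inverse of P, inherited from P through P s = r.\<close>

lemma s_r_commute: "s i \<bullet> r j = r i \<bullet> s j"
proof -
  have "s i \<bullet> r j = s i \<bullet> (P *\<^sub>v s j)" by (simp add: P_s)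
  also have "\<dots> = s j \<bullet> (P *\<^sub>v s i)" by (rule P.sym) simp_all
  also have "\<dots> = r i \<bullet> s j" by (simp add: P_s comm_scalar_prod[where n=d])
  finally show ?thesis .
qed

lemma \<rho>_eq_P: "\<rho> t = s t \<bullet> (P *\<^sub>v s t)"
  by (simp add: \<rho>_def P_s s_r_commute)

lemma \<rho>_nonneg: "0 \<le> \<rho> t"
  by (simp add: \<rho>_eq_P P.form_nonneg)

lemma \<rho>_pos:
  assumes "r t \<noteq> 0\<^sub>v d"
  shows "0 < \<rho> t"
proof -
  have "s t \<noteq> 0\<^sub>v d"
  proof
    assume "s t = 0\<^sub>v d"
    with P_s[of t] assms show False by (simp add: ip)
  qed
  then show ?thesis by (simp add: \<rho>_eq_P P.pos)
qed

text \<open>The classical invariants relative to all earlier steps: residuals orthogonal to search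
  directions, preconditioned residuals orthogonal for P, directions conjugate for H. The first
  equation identifies \<open>\<alpha> t\<close> with the exact line search along \<open>u t\<close>.
  They are bundled because each of them at the next step uses the others.\<close>

definition conjugate_upto where
  "conjugate_upto t \<longleftrightarrow> r t \<bullet> u t = \<rho> t \<and>
     (\<forall>j<t. r t \<bullet> u j = 0 \<and> r t \<bullet> s j = 0 \<and> u t \<bullet> (H *\<^sub>v u j) = 0)"

lemma curvature_pos:
  assumes "conjugate_upto t" "r t \<noteq> 0\<^sub>v d"
  shows "0 < u t \<bullet> (H *\<^sub>v u t)"
proof -
  have "u t \<noteq> 0\<^sub>v d"
  proof
    assume "u t = 0\<^sub>v d"
    with assms \<rho>_pos[of t] show False by (simp add: conjugate_upto_def)
  qed
  then show ?thesis by (simp add: H.pos)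
qed

text \<open>Nonzero residuals before \<open>t\<close> keep every quotient up to step
  \<open>t\<close> away from 0/0; \<open>r t\<close> itself may vanish, so the step of exact
  convergence is covered. Strong induction supplies positive step lengths at all earlier
  indices.\<close>

lemma conjugate_upto:
  assumes "\<And>i. i < t \<Longrightarrow> r i \<noteq> 0\<^sub>v d"
  shows "conjugate_upto t"
  using assms
proof (induction t rule: less_induct)
  case (less t)
  show ?case
  proof (cases t)
    case 0
    then show ?thesis by (simp add: conjugate_upto_def \<rho>_def step_0)
  next
    case (Suc t')
    have C: "conjugate_upto i" if "i \<le> t'" for i
      using less that Suc by auto
    have rn: "r i \<noteq> 0\<^sub>v d" if "i \<le> t'" for i
      using less that Suc by auto
    have \<alpha>: "\<alpha> i * (u i \<bullet> (H *\<^sub>v u i)) = \<rho> i" and \<alpha>_pos: "0 < \<alpha> i" if "i \<le> t'" for i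
      using curvature_pos[OF C[OF that] rn[OF that]] \<rho>_pos[OF rn[OF that]]
      by (simp_all add: \<alpha>_def \<rho>_def)
    have ru: "r (Suc t') \<bullet> u j = 0" if "j \<le> t'" for j
    proof -
      have "r (Suc t') \<bullet> u j = r t' \<bullet> u j - \<alpha> t' * ((H *\<^sub>v u t') \<bullet> u j)"
        by (simp add: step_Suc ip)
      also have "(H *\<^sub>v u t') \<bullet> u j = u t' \<bullet> (H *\<^sub>v u j)"
        by (subst comm_scalar_prod[where n=d]) (auto intro: H.sym)
      also have "r t' \<bullet> u j - \<alpha> t' * \<dots> = 0"
        using C[of t'] \<alpha>[of t'] that
        by (cases "j = t'") (auto simp: conjugate_upto_def)
      finally show ?thesis .
    qed
    have rs: "r (Suc t') \<bullet> s j = 0" if "j \<le> t'" for j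
    proof (cases j)
      case 0
      then show ?thesis using ru[of 0] by (simp add: step_0)
    next
      case (Suc i)
      have "r (Suc t') \<bullet> u (Suc i) = r (Suc t') \<bullet> s (Suc i) + \<beta> i * (r (Suc t') \<bullet> u i)"
        by (simp only: step_Suc(4)) (simp add: ip)
      with ru[of "Suc i"] ru[of i] Suc that show ?thesis by simp
    qed
    have sr: "s (Suc t') \<bullet> r j = 0" if "j \<le> t'" for j
      using rs[OF that] by (simp add: s_r_commute)
    have uHu: "u (Suc t') \<bullet> (H *\<^sub>v u j) = 0" if "j \<le> t'" for j
    proof -
      \<comment> \<open>The residual recurrence expresses \<alpha> j * H u j as a difference of
        residuals, which turns conjugacy into orthogonality of residuals; the positive factor
        \<alpha> j is cancelled at the end.\<close>
      have "s (Suc t') \<bullet> r (Suc j) = s (Suc t') \<bullet> r j - \<alpha> j * (s (Suc t') \<bullet> (H *\<^sub>v u j))"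
        by (simp only: step_Suc(2)) (simp add: ip)
      with sr[OF that] have
        sHu: "\<alpha> j * (s (Suc t') \<bullet> (H *\<^sub>v u j)) = - (s (Suc t') \<bullet> r (Suc j))" by simp
      have *: "\<alpha> j * (u (Suc t') \<bullet> (H *\<^sub>v u j)) =
        - (s (Suc t') \<bullet> r (Suc j)) + \<alpha> j * (\<beta> t' * (u t' \<bullet> (H *\<^sub>v u j)))"
        using sHu by (simp only: step_Suc(4)) (simp add: ip distrib_left)
      \<comment> \<open>For j = t' the two terms cancel, which is what \<beta> is chosen for; for
        smaller j each of them vanishes separately.\<close>
      have "\<dots> = 0"
      proof (cases "j = t'")
        case True
        then show ?thesis
          using \<alpha>[of t'] \<rho>_pos[OF rn[of t']]
          by (simp add: \<beta>_def s_r_commute \<rho>_def field_simps)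
      next
        case False
        then show ?thesis using that C[of t'] sr[of "Suc j"] by (simp add: conjugate_upto_def)
      qed
      with * \<alpha>_pos[OF that] show ?thesis by simp
    qed
    have "r (Suc t') \<bullet> u (Suc t') = \<rho> (Suc t')"
      using ru[of t'] by (simp only: step_Suc(4)) (simp add: ip \<rho>_def)
    then show ?thesis
      using ru rs uHu Suc by (auto simp: conjugate_upto_def less_Suc_eq_le)
  qed
qed

text \<open>Since s t = u t - \<beta> i * u i with conjugate directions, Pythagoras bounds the
  curvature along \<open>u t\<close> by that along \<open>s t\<close>, and H <= P does the rest. It
  means that step lengths are at least 1.\<close>

lemma curvature_le:
  assumes "conjugate_upto t"
  shows "u t \<bullet> (H *\<^sub>v u t) \<le> \<rho> t"
proof (cases t)
  case 0
  then show ?thesis using H_le_P[OF closed(3)[of 0]] by (simp add: \<rho>_eq_P step_0(4))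
next
  case (Suc i)
  have "u t \<bullet> (H *\<^sub>v u i) = 0"
    using assms Suc by (simp add: conjugate_upto_def)
  moreover have "s t = u t - \<beta> i \<cdot>\<^sub>v u i"
    unfolding Suc step_Suc(4) by (rule add_minus_eq_vec[where d=d, symmetric]) simp_all
  moreover have "u i \<bullet> (H *\<^sub>v u t) = u t \<bullet> (H *\<^sub>v u i)" by (rule H.sym) simp_all
  ultimately have "s t \<bullet> (H *\<^sub>v s t) = u t \<bullet> (H *\<^sub>v u t) + (\<beta> i)\<^sup>2 * (u i \<bullet> (H *\<^sub>v u i))"
    by (simp add: ip power2_eq_square)
  moreover have "0 \<le> (\<beta> i)\<^sup>2 * (u i \<bullet> (H *\<^sub>v u i))"
    by (simp add: H.form_nonneg)
  ultimately show ?thesis using H_le_P[of "s t"] by (simp add: \<rho>_eq_P)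
qed

section \<open>Decay of the energy\<close>

lemma energy_nonneg: "0 \<le> energy t"
  by (simp add: energy_def H.form_nonneg)

text \<open>Exact line search lowers the energy by \<alpha> t * \<rho> t, and
  \<open>curvature_le\<close> gives \<alpha> t >= 1.\<close>

lemma energy_decrease:
  assumes "\<And>i. i \<le> t \<Longrightarrow> r i \<noteq> 0\<^sub>v d"
  shows "energy (Suc t) + \<rho> t \<le> energy t"
proof -
  have C: "conjugate_upto t" by (rule conjugate_upto) (simp add: assms)
  define c where "c = u t \<bullet> (H *\<^sub>v u t)"
  have c: "0 < c" unfolding c_def by (rule curvature_pos[OF C]) (simp add: assms)
  have e: "x - v (Suc t) = (x - v t) - \<alpha> t \<cdot>\<^sub>v u t"
    unfolding step_Suc by (rule minus_add_eq_vec[where d=d]) simp_all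
  have ue: "u t \<bullet> (H *\<^sub>v (x - v t)) = \<rho> t"
    using C by (simp add: residual[symmetric] conjugate_upto_def comm_scalar_prod[where n=d])
  have "(x - v t) \<bullet> (H *\<^sub>v u t) = u t \<bullet> (H *\<^sub>v (x - v t))"
    by (rule H.sym) simp_all
  with ue have eu: "(x - v t) \<bullet> (H *\<^sub>v u t) = \<rho> t" by simp
  have "energy (Suc t) = energy t - 2 * \<alpha> t * \<rho> t + (\<alpha> t)\<^sup>2 * c"
  proof -
    define e where "e = x - v t"
    have [simp]: "e \<in> carrier_vec d" by (simp add: e_def)
    have "energy (Suc t) = (e - \<alpha> t \<cdot>\<^sub>v u t) \<bullet> (H *\<^sub>v (e - \<alpha> t \<cdot>\<^sub>v u t))"
      unfolding energy_def e e_def ..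
    also have "\<dots> = e \<bullet> (H *\<^sub>v e) - 2 * \<alpha> t * \<rho> t + (\<alpha> t)\<^sup>2 * c"
      using ue eu unfolding e_def[symmetric]
      by (simp add: ip c_def power2_eq_square algebra_simps)
    finally show ?thesis by (simp add: energy_def e_def)
  qed
  also have "\<alpha> t = \<rho> t / c" by (simp add: \<alpha>_def c_def \<rho>_def)
  also have "energy t - 2 * (\<rho> t / c) * \<rho> t + (\<rho> t / c)\<^sup>2 * c = energy t - \<rho> t * (\<rho> t / c)"
    using c by (simp add: power2_eq_square field_simps)
  finally have E: "energy (Suc t) = energy t - \<rho> t * (\<rho> t / c)" .
  have "1 \<le> \<rho> t / c" using c curvature_le[OF C] by (simp add: c_def)
  then have "\<rho> t * 1 \<le> \<rho> t * (\<rho> t / c)" by (intro mult_left_mono \<rho>_nonneg)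
  with E show ?thesis by simp
qed

lemma energy_antimono:
  assumes "i \<le> j" "\<And>k. k < j \<Longrightarrow> r k \<noteq> 0\<^sub>v d"
  shows "energy j \<le> energy i"
  using assms
proof (induction j rule: dec_induct)
  case (step j)
  then have "energy (Suc j) + \<rho> j \<le> energy j"
    by (intro energy_decrease) simp
  with step \<rho>_nonneg[of j] show ?case by simp
qed simp

text \<open>The later residual is orthogonal to every direction used between \<open>k\<close> and
  \<open>i\<close>, so the error at \<open>i\<close> may be replaced by the error at
  \<open>k\<close>. This anchors all later energies at one fixed vector.\<close>

lemma residual_scalar_prod_energy:
  assumes "k \<le> i" "\<And>j. j < i \<Longrightarrow> r j \<noteq> 0\<^sub>v d"
  shows "r i \<bullet> (x - v k) = energy i"
proof -
  have C: "conjugate_upto i" by (rule conjugate_upto) (simp add: assms)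
  have "r i \<bullet> v j = r i \<bullet> v k" if "k \<le> j" "j \<le> i" for j
    using that
  proof (induction j rule: dec_induct)
    case (step j)
    then show ?case using C by (simp add: step_Suc ip conjugate_upto_def)
  qed simp
  from this[of i] assms have "r i \<bullet> (x - v k) = r i \<bullet> (x - v i)" by (simp add: ip)
  then show ?thesis
    by (simp add: energy_def residual[symmetric] comm_scalar_prod[where n=d])
qed

fun partial_sum where
  "partial_sum k 0 = 0\<^sub>v d"
| "partial_sum k (Suc N) = partial_sum k N + s (k + N)"

lemma partial_sum_closed [simp]: "partial_sum k N \<in> carrier_vec d"
  by (induction N) simp_all

text \<open>
  The \<open>s i\<close> are orthogonal in the \<open>P\<close>-inner product, so the squared \<open>P\<close>-norm of their sum
  telescopes and is at most the energy at time \<open>k\<close>; pairing the sum with the error at time \<open>k\<close>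
  gives the sum of all later energies. This yields the square root of the condition number without
  Chebyshev polynomials.
\<close>

lemma sum_energy_le:
  assumes rn: "\<And>j. j < k + N \<Longrightarrow> r j \<noteq> 0\<^sub>v d"
  shows "(\<Sum>i<N. energy (k + i)) \<le> sqrt \<kappa> * energy k"
proof -
  have C: "conjugate_upto i" if "i \<le> k + N" for i
    using that by (intro conjugate_upto rn) simp
  have N: "(P *\<^sub>v partial_sum k M) \<bullet> (x - v k) = (\<Sum>i<M. energy (k + i)) \<and>
      partial_sum k M \<bullet> (P *\<^sub>v partial_sum k M) + energy (k + M) \<le> energy k" if "M \<le> N" for M
    using that
  proof (induction M)
    case 0
    then show ?case by (simp add: ip)
  next
    case (Suc M)
    have o: "partial_sum k j \<bullet> r (k + M) = 0" if "j \<le> M" for j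
      using that
    proof (induction j)
      case (Suc j)
      have "s (k + j) \<bullet> r (k + M) = r (k + M) \<bullet> s (k + j)"
        by (rule comm_scalar_prod[where n=d]) simp_all
      also have "\<dots> = 0"
        using C[of "k + M"] \<open>Suc M \<le> N\<close> Suc.prems by (simp add: conjugate_upto_def)
      finally show ?case using Suc by (simp add: ip)
    qed simp
    have "s (k + M) \<bullet> (P *\<^sub>v partial_sum k M) = partial_sum k M \<bullet> (P *\<^sub>v s (k + M))"
      by (rule P.sym) simp_all
    also have "\<dots> = 0" using o[of M] by (simp add: P_s)
    finally have "partial_sum k (Suc M) \<bullet> (P *\<^sub>v partial_sum k (Suc M)) =
      partial_sum k M \<bullet> (P *\<^sub>v partial_sum k M) + \<rho> (k + M)"
      using o[of M] by (simp add: ip P_s \<rho>_def s_r_commute)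
    moreover have "energy (Suc (k + M)) + \<rho> (k + M) \<le> energy (k + M)"
      using Suc.prems by (intro energy_decrease rn) simp
    moreover have "r (k + M) \<bullet> (x - v k) = energy (k + M)"
      using Suc.prems by (intro residual_scalar_prod_energy rn) simp_all
    moreover have "(P *\<^sub>v partial_sum k (Suc M)) \<bullet> (x - v k) =
      (P *\<^sub>v partial_sum k M) \<bullet> (x - v k) + r (k + M) \<bullet> (x - v k)"
      by (simp only: partial_sum.simps) (simp add: ip P_s del: minus_scalar_prod_distrib)
    ultimately show ?case using Suc by simp
  qed
  let ?S = "partial_sum k N" and ?e = "x - v k"
  let ?E = "\<Sum>i<N. energy (k + i)"
  have S: "?S \<bullet> (P *\<^sub>v ?S) \<le> energy k" using N[of N] energy_nonneg[of "k + N"] by simp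
  have e: "?e \<bullet> (P *\<^sub>v ?e) \<le> \<kappa> * energy k" unfolding energy_def by (rule P_le_H) simp
  have "?E = ?e \<bullet> (P *\<^sub>v ?S)"
    using N[of N] by (simp add: comm_scalar_prod[where n=d])
  then have "?E\<^sup>2 \<le> (?e \<bullet> (P *\<^sub>v ?e)) * (?S \<bullet> (P *\<^sub>v ?S))"
    using P.cauchy_schwarz[of ?e ?S] by simp
  also have "\<dots> \<le> (\<kappa> * energy k) * energy k"
    by (rule mult_mono[OF e S])
      (use order_trans[OF P.form_nonneg e] in \<open>simp_all add: P.form_nonneg\<close>)
  finally have "sqrt (?E\<^sup>2) \<le> sqrt (\<kappa> * (energy k)\<^sup>2)"
    unfolding real_sqrt_le_iff by (simp add: power2_eq_square mult.assoc)
  also have "\<dots> = sqrt \<kappa> * energy k"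
    using energy_nonneg[of k] by (simp add: real_sqrt_mult)
  finally show ?thesis by simp
qed

text \<open>Energies decrease, so the last one is at most the average over a block of N steps, and
  by \<open>sum_energy_le\<close> that average is at most sqrt \<kappa> / N <= 1/2 times the energy
  at the start of the block.\<close>

lemma energy_geometric:
  assumes N: "2 * sqrt \<kappa> \<le> real N" and N_pos: "0 < N"
    and rn: "\<And>i. i < j * N \<Longrightarrow> r i \<noteq> 0\<^sub>v d"
  shows "energy (j * N) \<le> energy 0 / 2 ^ j"
  using rn
proof (induction j)
  case (Suc j)
  let ?k = "j * N"
  have r: "r i \<noteq> 0\<^sub>v d" if "i < ?k + N" for i using Suc.prems[of i] that by simp
  have "real N * energy (?k + N) = (\<Sum>i<N. energy (?k + N))" by simp
  also have "\<dots> \<le> (\<Sum>i<N. energy (?k + i))"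
    by (intro sum_mono energy_antimono r) simp_all
  also have "\<dots> \<le> sqrt \<kappa> * energy ?k" by (rule sum_energy_le[OF r])
  also have "\<dots> \<le> real N / 2 * energy ?k"
    using N energy_nonneg[of ?k] by (intro mult_right_mono) simp_all
  finally have "real N * energy (?k + N) \<le> real N * (energy ?k / 2)" by simp
  then have "energy (?k + N) \<le> energy ?k / 2" using N_pos by simp
  also have "energy ?k \<le> energy 0 / 2 ^ j" using Suc by simp
  finally show ?case by (simp add: add.commute)
qed simp

text \<open>Passing from residual to energy and back costs the factor L / l. An index up to j * N is
  asserted rather than j * N itself because an earlier zero residual ends the valid recurrence; it
  is then the witness. The bound 1 <= t mirrors the stopping test.\<close>

lemma residual_geometric:
  assumes N: "2 * sqrt \<kappa> \<le> real N" "0 < N" and j: "0 < j" and "g \<noteq> 0\<^sub>v d"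
  shows "\<exists>t. 1 \<le> t \<and> t \<le> j * N \<and> (norm2 (r t))\<^sup>2 \<le> L / (l * 2 ^ j) * (norm2 g)\<^sup>2"
proof -
  have L: "0 \<le> L"
  proof -
    have "0 \<le> g \<bullet> (H *\<^sub>v g)" by (simp add: H.form_nonneg g_closed)
    also have "\<dots> \<le> L * (g \<bullet> g)" by (simp add: H.upper g_closed)
    finally show ?thesis
      using scalar_prod_self_pos[OF g_closed assms(4)] by (simp add: zero_le_mult_iff)
  qed
  show ?thesis
  proof (cases "\<exists>t\<le>j * N. r t = 0\<^sub>v d")
    case True
    then obtain t where t: "t \<le> j * N" "r t = 0\<^sub>v d" by auto
    with assms(4) have "t \<noteq> 0" by (metis step_0(2))
    moreover have "norm2 (r t) = 0" by (simp add: t norm2_def)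
    ultimately show ?thesis using t L H.l_pos by (intro exI[of _ t]) simp
  next
    case False
    then have "energy (j * N) \<le> energy 0 / 2 ^ j" by (intro energy_geometric N) auto
    moreover have "l * energy 0 \<le> (norm2 g)\<^sup>2"
      using H.image_lower[OF x] by (simp add: energy_def error_0 norm2_squared flip: g)
    then have "energy 0 \<le> (norm2 g)\<^sup>2 / l" using H.l_pos by (simp add: field_simps)
    ultimately have "energy (j * N) \<le> (norm2 g)\<^sup>2 / l / 2 ^ j"
      by (meson divide_right_mono order_trans zero_le_numeral zero_le_power)
    then have "L * energy (j * N) \<le> L * ((norm2 g)\<^sup>2 / l / 2 ^ j)"
      using L by (rule mult_left_mono)
    moreover have "(norm2 (r (j * N)))\<^sup>2 \<le> L * energy (j * N)"
      using H.image_upper[of "x - v (j * N)"] by (simp add: residual norm2_squared energy_def)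
    ultimately show ?thesis
      using j N by (intro exI[of _ "j * N"]) (simp add: field_simps)
  qed
qed

end

section \<open>Concentration of sums of bounded random vectors\<close>

locale bounded_random_vector = prob_space D for D :: "'a measure" +
  fixes J :: "'j set" and X :: "'a \<Rightarrow> 'j \<Rightarrow> real" and R :: real
  assumes finite_J [simp]: "finite J"
    and X_measurable [measurable]: "\<And>j. j \<in> J \<Longrightarrow> (\<lambda>z. X z j) \<in> borel_measurable D"
    and X_bound: "AE z in D. (\<Sum>j\<in>J. (X z j)\<^sup>2) \<le> R\<^sup>2"
    and R_nonneg: "0 \<le> R"
begin

lemma component_bound:
  assumes "j \<in> J"
  shows "AE z in D. \<bar>X z j\<bar> \<le> R"
  using X_bound
proof eventually_elim
  case (elim z)
  have "(X z j)\<^sup>2 \<le> (\<Sum>j\<in>J. (X z j)\<^sup>2)"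
    using assms by (intro member_le_sum) simp_all
  with elim have "(X z j)\<^sup>2 \<le> R\<^sup>2" by simp
  with R_nonneg show ?case by (simp add: abs_le_square_iff[symmetric])
qed

lemma component_integrable: "j \<in> J \<Longrightarrow> integrable D (\<lambda>z. X z j)"
  using component_bound by (intro integrable_const_bound[where B=R]) auto

text \<open>With mean \<mu>, |\<mu>|^2 is the expectation of <\<mu>, X>, hence at most (|\<mu>|^2 +
  R^2) / 2; solving for |\<mu>|^2 gives the bound.\<close>

lemma mean_bound: "(\<Sum>j\<in>J. (expectation (\<lambda>z. X z j))\<^sup>2) \<le> R\<^sup>2"
proof -
  define \<mu> where "\<mu> j = expectation (\<lambda>z. X z j)" for j
  have "(\<Sum>j\<in>J. (\<mu> j)\<^sup>2) = (\<Sum>j\<in>J. expectation (\<lambda>z. \<mu> j * X z j))"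
    by (simp add: \<mu>_def power2_eq_square)
  also have "\<dots> = expectation (\<lambda>z. \<Sum>j\<in>J. \<mu> j * X z j)"
    by (rule Bochner_Integration.integral_sum[symmetric]) (simp add: component_integrable)
  also have "\<dots> \<le> expectation (\<lambda>z. ((\<Sum>j\<in>J. (\<mu> j)\<^sup>2) + R\<^sup>2) / 2)"
  proof (rule integral_mono_AE)
    show "AE z in D. (\<Sum>j\<in>J. \<mu> j * X z j) \<le> ((\<Sum>j\<in>J. (\<mu> j)\<^sup>2) + R\<^sup>2) / 2"
      using X_bound
    proof eventually_elim
      case (elim z)
      have "\<mu> j * X z j \<le> ((\<mu> j)\<^sup>2 + (X z j)\<^sup>2) / 2" for j
        using sum_squares_bound[of "\<mu> j" "X z j"] by simp
      then have "(\<Sum>j\<in>J. \<mu> j * X z j) \<le> (\<Sum>j\<in>J. ((\<mu> j)\<^sup>2 + (X z j)\<^sup>2) / 2)"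
        by (intro sum_mono)
      also have "\<dots> = ((\<Sum>j\<in>J. (\<mu> j)\<^sup>2) + (\<Sum>j\<in>J. (X z j)\<^sup>2)) / 2"
        by (simp add: sum.distrib flip: sum_divide_distrib)
      finally show ?case using elim by simp
    qed
  qed (auto simp: component_integrable)
  also have "\<dots> = ((\<Sum>j\<in>J. (\<mu> j)\<^sup>2) + R\<^sup>2) / 2"
    by (simp add: prob_space)
  finally show ?thesis by (simp add: \<mu>_def)
qed

text \<open>The radius 2 R comes from |X - \<mu>|^2 <= 2 |X|^2 + 2 |\<mu>|^2 together with
  \<open>mean_bound\<close>.\<close>

lemma centered: "bounded_random_vector D J (\<lambda>z j. X z j - expectation (\<lambda>z. X z j)) (2 * R)"
proof unfold_locales
  show "AE z in D. (\<Sum>j\<in>J. (X z j - expectation (\<lambda>z. X z j))\<^sup>2) \<le> (2 * R)\<^sup>2"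
    using X_bound
  proof eventually_elim
    case (elim z)
    have "(a - b)\<^sup>2 \<le> 2 * a\<^sup>2 + 2 * b\<^sup>2" for a b :: real
      using sum_squares_bound[of "- a" b] by (simp add: power2_diff)
    then have "(\<Sum>j\<in>J. (X z j - expectation (\<lambda>z. X z j))\<^sup>2)
        \<le> (\<Sum>j\<in>J. 2 * (X z j)\<^sup>2 + 2 * (expectation (\<lambda>z. X z j))\<^sup>2)"
      by (intro sum_mono)
    also have "\<dots> = 2 * (\<Sum>j\<in>J. (X z j)\<^sup>2) + 2 * (\<Sum>j\<in>J. (expectation (\<lambda>z. X z j))\<^sup>2)"
      by (simp add: sum.distrib sum_distrib_left)
    finally show ?case using elim mean_bound by simp
  qed
qed (simp_all add: R_nonneg)

end

section \<open>Exponential moments of the squared norm\<close>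

locale centered_random_vector = bounded_random_vector +
  assumes X_centered: "\<And>j. j \<in> J \<Longrightarrow> expectation (\<lambda>z. X z j) = 0"
begin

text \<open>Expanding |s + a X|^2 leaves |s|^2, a term at most a^2 R^2, and a linear term that is a
  centered scalar variable of size at most |a| R |s|. The scalar Hoeffding lemma handles the latter,
  so the dimension never enters.\<close>

lemma exp_square_shift:
  assumes c: "0 < c"
  shows "(\<integral>\<^sup>+ z. ennreal (exp (c * (\<Sum>j\<in>J. (s j + a * X z j)\<^sup>2))) \<partial>D)
    \<le> ennreal (exp (c * (a\<^sup>2 * R\<^sup>2)) * exp ((c + 2 * c\<^sup>2 * (a\<^sup>2 * R\<^sup>2)) * (\<Sum>j\<in>J. (s j)\<^sup>2)))"
proof -
  define S where "S = (\<Sum>j\<in>J. (s j)\<^sup>2)"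
  define K where "K = sqrt (a\<^sup>2 * R\<^sup>2 * S)"
  define f where "f z = (\<Sum>j\<in>J. (a * s j) * X z j)" for z
  have S: "0 \<le> S" unfolding S_def by (intro sum_nonneg) simp
  have K2: "K\<^sup>2 = a\<^sup>2 * R\<^sup>2 * S" using S by (simp add: K_def)
  have K: "0 \<le> K" using S by (simp add: K_def)
  have f_bound: "AE z in D. f z \<in> {-K..K}"
    using X_bound
  proof eventually_elim
    case (elim z)
    have "(f z)\<^sup>2 \<le> (\<Sum>j\<in>J. (a * s j)\<^sup>2) * (\<Sum>j\<in>J. (X z j)\<^sup>2)"
      unfolding f_def by (rule Cauchy_Schwarz_ineq_sum)
    also have "\<dots> \<le> (\<Sum>j\<in>J. (a * s j)\<^sup>2) * R\<^sup>2"
      by (intro mult_left_mono elim sum_nonneg) simp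
    also have "\<dots> = K\<^sup>2"
      by (simp add: K2 S_def power_mult_distrib sum_distrib_left sum_distrib_right mult_ac)
    finally show ?case using K by (auto simp: abs_le_square_iff[symmetric])
  qed
  have [measurable]: "f \<in> borel_measurable D" unfolding f_def by simp
  interpret f: interval_bounded_random_variable D f "- K" K
    by unfold_locales (simp_all add: f_bound del: atLeastAtMost_iff)
  have "expectation f = 0"
    unfolding f_def
    by (subst Bochner_Integration.integral_sum) (auto simp: component_integrable X_centered)
  then have hoeffding:
    "(\<integral>\<^sup>+ z. ennreal (exp (2 * c * f z)) \<partial>D) \<le> ennreal (exp ((2 * c)\<^sup>2 * (K - - K)\<^sup>2 / 8))"
    using c by (intro f.Hoeffdings_lemma_nn_integral_0) simp_all
  have "(\<integral>\<^sup>+ z. ennreal (exp (c * (\<Sum>j\<in>J. (s j + a * X z j)\<^sup>2))) \<partial>D)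
     \<le> (\<integral>\<^sup>+ z. ennreal (exp (c * S + c * (a\<^sup>2 * R\<^sup>2))) * ennreal (exp (2 * c * f z)) \<partial>D)"
  proof (rule nn_integral_mono_AE)
    show "AE z in D. ennreal (exp (c * (\<Sum>j\<in>J. (s j + a * X z j)\<^sup>2)))
       \<le> ennreal (exp (c * S + c * (a\<^sup>2 * R\<^sup>2))) * ennreal (exp (2 * c * f z))"
      using X_bound
    proof eventually_elim
      case (elim z)
      have "(\<Sum>j\<in>J. (s j + a * X z j)\<^sup>2) = S + 2 * f z + a\<^sup>2 * (\<Sum>j\<in>J. (X z j)\<^sup>2)"
        by (simp add: S_def f_def sum.distrib sum_distrib_left power2_sum power_mult_distrib mult_ac)
      also have "\<dots> \<le> S + 2 * f z + a\<^sup>2 * R\<^sup>2"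
        using elim by (intro add_mono mult_left_mono) simp_all
      finally have "c * (\<Sum>j\<in>J. (s j + a * X z j)\<^sup>2) \<le> c * (S + 2 * f z + a\<^sup>2 * R\<^sup>2)"
        using c by (intro mult_left_mono) simp_all
      then show ?case
        by (simp add: algebra_simps flip: ennreal_mult exp_add)
    qed
  qed
  also have "\<dots> = ennreal (exp (c * S + c * (a\<^sup>2 * R\<^sup>2))) * (\<integral>\<^sup>+ z. ennreal (exp (2 * c * f z)) \<partial>D)"
    by (rule nn_integral_cmult) simp
  also have "\<dots> \<le> ennreal (exp (c * S + c * (a\<^sup>2 * R\<^sup>2))) * ennreal (exp ((2 * c)\<^sup>2 * (K - - K)\<^sup>2 / 8))"
    by (intro mult_left_mono hoeffding) simp
  also have "\<dots> = ennreal (exp (c * S + c * (a\<^sup>2 * R\<^sup>2) + (2 * c)\<^sup>2 * (K - - K)\<^sup>2 / 8))"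
    by (simp add: exp_add ennreal_mult)
  also have "(2 * c)\<^sup>2 * (K - - K)\<^sup>2 / 8 = 2 * c\<^sup>2 * (a\<^sup>2 * R\<^sup>2) * S"
    by (simp add: K2 power_mult_distrib flip: mult_2)
  also have "c * S + c * (a\<^sup>2 * R\<^sup>2) + 2 * c\<^sup>2 * (a\<^sup>2 * R\<^sup>2) * S
     = c * (a\<^sup>2 * R\<^sup>2) + (c + 2 * c\<^sup>2 * (a\<^sup>2 * R\<^sup>2)) * S"
    by (simp add: algebra_simps)
  finally show ?thesis by (simp add: S_def exp_add)
qed

lemma product_measurable:
  assumes "j \<in> J" "p \<in> I"
  shows "(\<lambda>x. X (x p) j) \<in> borel_measurable (\<Pi>\<^sub>M p\<in>I. D)"
  using measurable_compose[OF measurable_component_singleton[OF assms(2), of "\<lambda>_. D"] X_measurable[OF assms(1)]] .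

text \<open>
  Integrating out one summand replaces \<open>c\<close> by \<open>c + 2c\<^sup>2b \<le> c / (1 - 2cb)\<close>, and \<open>c / (1 - 2c\<sigma>)\<close> is
  stable under this substitution.
\<close>

lemma exp_square_sum:
  assumes "finite I" "0 < c" "2 * c * (\<Sum>p\<in>I. (a p)\<^sup>2 * R\<^sup>2) < 1"
  shows "(\<integral>\<^sup>+ x. ennreal (exp (c * (\<Sum>j\<in>J. (s j + (\<Sum>p\<in>I. a p * X (x p) j))\<^sup>2))) \<partial>(\<Pi>\<^sub>M p\<in>I. D))
    \<le> ennreal (exp (c * ((\<Sum>p\<in>I. (a p)\<^sup>2 * R\<^sup>2) + (\<Sum>j\<in>J. (s j)\<^sup>2)) / (1 - 2 * c * (\<Sum>p\<in>I. (a p)\<^sup>2 * R\<^sup>2))))"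
  using assms
proof (induction I arbitrary: c rule: finite_induct)
  case empty
  interpret product_sigma_finite "\<lambda>_. D" by unfold_locales
  show ?case by (simp add: space_PiM)
next
  case (insert p I)
  interpret product_sigma_finite "\<lambda>_. D" by unfold_locales
  note [measurable] = product_measurable
  define \<sigma> b S where "\<sigma> = (\<Sum>p\<in>I. (a p)\<^sup>2 * R\<^sup>2)" and "b = (a p)\<^sup>2 * R\<^sup>2" and "S = (\<Sum>j\<in>J. (s j)\<^sup>2)"
  define c' where "c' = c + 2 * c\<^sup>2 * b"
  have \<sigma>: "0 \<le> \<sigma>" unfolding \<sigma>_def by (intro sum_nonneg) simp
  have b: "0 \<le> b" by (simp add: b_def)
  have S: "0 \<le> S" unfolding S_def by (intro sum_nonneg) simp
  have c: "0 < c" by fact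
  have sum: "(\<Sum>p\<in>insert p I. (a p)\<^sup>2 * R\<^sup>2) = b + \<sigma>"
    using insert by (simp add: \<sigma>_def b_def)
  have lt: "2 * c * b + 2 * c * \<sigma> < 1" using insert.prems unfolding sum by (simp add: algebra_simps)
  have "0 \<le> 2 * c * \<sigma>" "0 \<le> 2 * c * b" using c \<sigma> b by simp_all
  with lt have lt_b: "2 * c * b < 1" and lt': "0 < 1 - 2 * c * b - 2 * c * \<sigma>" by linarith+
  have c'_pos: "0 < c'" unfolding c'_def using c b by (intro add_pos_nonneg) simp_all
  \<comment> \<open>The substitution inequality in multiplicative form, a difference of
    squares.\<close>
  have "c' * (1 - 2 * c * b) = c * (1 - (2 * c * b)\<^sup>2)"
    by (simp add: c'_def power2_eq_square algebra_simps)
  also have "\<dots> \<le> c * 1" using c by (intro mult_left_mono) simp_all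
  finally have c'_le: "c' * (1 - 2 * c * b) \<le> c" by simp
  have "c' * (1 - 2 * c * b) * (2 * \<sigma>) \<le> c * (2 * \<sigma>)"
    using c'_le \<sigma> by (intro mult_right_mono) simp_all
  also have "\<dots> < (1 - 2 * c * b) * 1" using lt' by simp
  finally have "(1 - 2 * c * b) * (2 * c' * \<sigma>) < (1 - 2 * c * b) * 1" by (simp add: mult_ac)
  then have c'_\<sigma>: "2 * c' * \<sigma> < 1" using lt_b by simp
  have "c' * (1 - 2 * c * b - 2 * c * \<sigma>) \<le> c * (1 - 2 * c' * \<sigma>)"
    using c'_le by (simp add: algebra_simps)
  then have ratio: "c' / (1 - 2 * c' * \<sigma>) \<le> c / (1 - 2 * c * b - 2 * c * \<sigma>)"
    using lt' c'_\<sigma> by (simp add: field_simps)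
  have one: "c \<le> c / (1 - 2 * c * b - 2 * c * \<sigma>)"
    using lt' c b \<sigma> by (simp add: field_simps)
  have expo: "c * b + c' * (\<sigma> + S) / (1 - 2 * c' * \<sigma>) \<le> c * ((b + \<sigma>) + S) / (1 - 2 * c * (b + \<sigma>))"
  proof -
    have "c * b + c' / (1 - 2 * c' * \<sigma>) * (\<sigma> + S)
       \<le> c / (1 - 2 * c * b - 2 * c * \<sigma>) * b + c / (1 - 2 * c * b - 2 * c * \<sigma>) * (\<sigma> + S)"
      using \<sigma> S b by (intro add_mono mult_right_mono ratio one) simp_all
    also have "\<dots> = c / (1 - 2 * c * b - 2 * c * \<sigma>) * ((b + \<sigma>) + S)"
      by (simp only: distrib_left add.assoc)
    also have "1 - 2 * c * b - 2 * c * \<sigma> = 1 - 2 * c * (b + \<sigma>)" by (simp add: algebra_simps)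
    finally show ?thesis by simp
  qed
  \<comment> \<open>The coordinate \<open>p\<close> is integrated first, with the sum over
    \<open>I\<close> absorbed into the shift; the induction hypothesis is then used at c', which is
    why \<open>c\<close> is generalized.\<close>
  let ?f = "\<lambda>x. \<Sum>j\<in>J. (s j + (\<Sum>p\<in>I. a p * X (x p) j))\<^sup>2"
  have "(\<integral>\<^sup>+ x. ennreal (exp (c * (\<Sum>j\<in>J. (s j + (\<Sum>q\<in>insert p I. a q * X (x q) j))\<^sup>2)))
          \<partial>(\<Pi>\<^sub>M p\<in>insert p I. D)) =
    (\<integral>\<^sup>+ x. \<integral>\<^sup>+ y. ennreal (exp (c * (\<Sum>j\<in>J. (s j +
        (\<Sum>q\<in>insert p I. a q * X ((x(p := y)) q) j))\<^sup>2))) \<partial>D \<partial>(\<Pi>\<^sub>M p\<in>I. D))"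
    using insert.hyps by (intro product_nn_integral_insert) auto
  also have "\<dots> = (\<integral>\<^sup>+ x. \<integral>\<^sup>+ y. ennreal (exp (c * (\<Sum>j\<in>J. ((s j +
        (\<Sum>q\<in>I. a q * X (x q) j)) + a p * X y j)\<^sup>2))) \<partial>D \<partial>(\<Pi>\<^sub>M p\<in>I. D))"
  proof -
    have "(\<Sum>q\<in>insert p I. a q * X ((x(p := y)) q) j) = (\<Sum>q\<in>I. a q * X (x q) j) + a p * X y j" for x y j
      using insert.hyps by (auto simp: intro!: sum.cong)
    then show ?thesis by (simp add: add.assoc)
  qed
  also have "\<dots> \<le> (\<integral>\<^sup>+ x. ennreal (exp (c * b) * exp (c' * ?f x)) \<partial>(\<Pi>\<^sub>M p\<in>I. D))"
    unfolding b_def c'_def by (intro nn_integral_mono exp_square_shift c)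
  also have "\<dots> = ennreal (exp (c * b)) * (\<integral>\<^sup>+ x. ennreal (exp (c' * ?f x)) \<partial>(\<Pi>\<^sub>M p\<in>I. D))"
    by (subst nn_integral_cmult[symmetric]) (auto simp: ennreal_mult)
  also have "\<dots> \<le> ennreal (exp (c * b)) * ennreal (exp (c' * (\<sigma> + S) / (1 - 2 * c' * \<sigma>)))"
    using c'_\<sigma> c'_pos unfolding \<sigma>_def S_def by (intro mult_left_mono insert.IH) simp_all
  also have "\<dots> = ennreal (exp (c * b + c' * (\<sigma> + S) / (1 - 2 * c' * \<sigma>)))"
    by (simp add: exp_add ennreal_mult)
  also have "\<dots> \<le> ennreal (exp (c * ((b + \<sigma>) + S) / (1 - 2 * c * (b + \<sigma>))))"
    using expo by (intro ennreal_leI) simp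
  finally show ?case unfolding sum S_def .
qed

lemma square_sum_tail:
  assumes I: "finite I" and \<sigma>: "(\<Sum>p\<in>I. (a p)\<^sup>2 * R\<^sup>2) \<le> \<sigma>" "0 < \<sigma>"
  shows "measure (\<Pi>\<^sub>M p\<in>I. D) {x \<in> space (\<Pi>\<^sub>M p\<in>I. D). t \<le> (\<Sum>j\<in>J. (\<Sum>p\<in>I. a p * X (x p) j)\<^sup>2)}
    \<le> exp (1 / 6 - t / (8 * \<sigma>))"
proof -
  let ?M = "\<Pi>\<^sub>M p\<in>I. D"
  \<comment> \<open>The summand 0 exhibits the instance s = 0 of
    \<open>exp_square_sum\<close>.\<close>
  let ?f = "\<lambda>x. \<Sum>j\<in>J. (0 + (\<Sum>p\<in>I. a p * X (x p) j))\<^sup>2"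
  \<comment> \<open>This choice gives 2 c \<sigma>' <= 1/4, hence an exponent of at most (1/8) /
    (3/4) = 1/6.\<close>
  define c where "c = 1 / (8 * \<sigma>)"
  define \<sigma>' where "\<sigma>' = (\<Sum>p\<in>I. (a p)\<^sup>2 * R\<^sup>2)"
  note [measurable] = product_measurable
  have c: "0 < c" using \<sigma> by (simp add: c_def)
  have "2 * c * \<sigma>' \<le> 2 * c * \<sigma>" using c \<sigma> by (simp add: \<sigma>'_def)
  also have "\<dots> = 1 / 4" using \<sigma> by (simp add: c_def)
  finally have c\<sigma>: "2 * c * \<sigma>' \<le> 1 / 4" .
  have "emeasure ?M {x \<in> space ?M. t \<le> ?f x}
     = emeasure ?M {x \<in> space ?M. 1 \<le> ennreal (exp (- c * t)) * ennreal (exp (c * ?f x))}"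
    using c by (intro arg_cong[where f="emeasure ?M"])
      (auto simp flip: ennreal_mult exp_add simp: mult_le_cancel_left_pos)
  also have "\<dots> \<le> ennreal (exp (- c * t)) * (\<integral>\<^sup>+ x. ennreal (exp (c * ?f x)) * indicator (space ?M) x \<partial>?M)"
    by (rule nn_integral_Markov_inequality) auto
  also have "(\<integral>\<^sup>+ x. ennreal (exp (c * ?f x)) * indicator (space ?M) x \<partial>?M)
     = (\<integral>\<^sup>+ x. ennreal (exp (c * ?f x)) \<partial>?M)"
    by (intro nn_integral_cong) auto
  also have "\<dots> \<le> ennreal (exp (c * (\<sigma>' + (\<Sum>j\<in>J. 0\<^sup>2)) / (1 - 2 * c * \<sigma>')))"
    unfolding \<sigma>'_def using I c c\<sigma> by (intro exp_square_sum) (auto simp: \<sigma>'_def)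
  also have "\<dots> \<le> ennreal (exp (1 / 6))"
    using c\<sigma> by (intro ennreal_leI) (simp add: field_simps)
  finally have "emeasure ?M {x \<in> space ?M. t \<le> ?f x} \<le> ennreal (exp (- c * t)) * ennreal (exp (1 / 6))"
    by (simp add: mult_left_mono)
  also have "\<dots> = ennreal (exp (1 / 6 - t / (8 * \<sigma>)))"
    by (simp add: c_def flip: ennreal_mult exp_add)
  finally have *: "emeasure ?M {x \<in> space ?M. t \<le> ?f x} \<le> ennreal (exp (1 / 6 - t / (8 * \<sigma>)))" .
  interpret P: prob_space ?M by (intro prob_space_PiM) unfold_locales
  show ?thesis using * by (simp add: P.emeasure_eq_measure)
qed

end

text \<open>Coefficients with sum zero annihilate the unknown mean, so centering leaves the
  combination unchanged and only doubles the radius.\<close>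

lemma (in bounded_random_vector) balanced_sum_tail:
  assumes I: "finite I" and a: "(\<Sum>p\<in>I. a p) = 0"
    and \<sigma>: "(\<Sum>p\<in>I. (a p)\<^sup>2) * (2 * R)\<^sup>2 \<le> \<sigma>" "0 < \<sigma>"
  shows "measure (\<Pi>\<^sub>M p\<in>I. D) {x \<in> space (\<Pi>\<^sub>M p\<in>I. D). t \<le> (\<Sum>j\<in>J. (\<Sum>p\<in>I. a p * X (x p) j)\<^sup>2)}
    \<le> exp (1 / 6 - t / (8 * \<sigma>))"
proof -
  interpret C: bounded_random_vector D J "\<lambda>z j. X z j - expectation (\<lambda>z. X z j)" "2 * R"
    by (rule centered)
  interpret C: centered_random_vector D J "\<lambda>z j. X z j - expectation (\<lambda>z. X z j)" "2 * R"
    by unfold_locales (simp add: component_integrable prob_space)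
  have "(\<Sum>p\<in>I. a p * (X (x p) j - expectation (\<lambda>z. X z j))) = (\<Sum>p\<in>I. a p * X (x p) j)" for x j
    using a by (simp add: right_diff_distrib sum_subtractf flip: sum_distrib_right)
  then show ?thesis
    using C.square_sum_tail[OF I, of a \<sigma> t] \<sigma> by (simp add: sum_distrib_right)
qed

section \<open>DiSCO on quadratic objectives\<close>

context spd_matrix
begin

definition form_norm where "form_norm v = sqrt (v \<bullet> (A *\<^sub>v v))"

lemma form_norm_nonneg: "v \<in> carrier_vec d \<Longrightarrow> 0 \<le> form_norm v"
  by (simp add: form_norm_def form_nonneg)

lemma form_norm_squared: "v \<in> carrier_vec d \<Longrightarrow> (form_norm v)\<^sup>2 = v \<bullet> (A *\<^sub>v v)"
  by (simp add: form_norm_def form_nonneg)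

lemma form_norm_scale:
  assumes "v \<in> carrier_vec d" "0 \<le> c"
  shows "form_norm (c \<cdot>\<^sub>v v) = c * form_norm v"
proof -
  have "(c \<cdot>\<^sub>v v) \<bullet> (A *\<^sub>v (c \<cdot>\<^sub>v v)) = c\<^sup>2 * (v \<bullet> (A *\<^sub>v v))"
    using assms by (simp add: scalar_prod_vec_simps[where d=d] mult_mat_vec_simps[OF carrier] power2_eq_square)
  then show ?thesis using assms(2) by (simp add: form_norm_def real_sqrt_mult)
qed

lemma form_norm_triangle:
  assumes u: "u \<in> carrier_vec d" and v: "v \<in> carrier_vec d"
  shows "form_norm (u + v) \<le> form_norm u + form_norm v"
    and "form_norm (u - v) \<le> form_norm u + form_norm v"
proof -
  have "(u \<bullet> (A *\<^sub>v v))\<^sup>2 \<le> (form_norm u * form_norm v)\<^sup>2"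
    using cauchy_schwarz[OF u v] u v by (simp add: power_mult_distrib form_norm_squared)
  then have *: "\<bar>u \<bullet> (A *\<^sub>v v)\<bar> \<le> form_norm u * form_norm v"
    using form_norm_nonneg[OF u] form_norm_nonneg[OF v] by (simp add: abs_le_square_iff[symmetric] abs_mult)
  have "(form_norm (u + v))\<^sup>2 = (form_norm u)\<^sup>2 + 2 * (u \<bullet> (A *\<^sub>v v)) + (form_norm v)\<^sup>2"
    "(form_norm (u - v))\<^sup>2 = (form_norm u)\<^sup>2 - 2 * (u \<bullet> (A *\<^sub>v v)) + (form_norm v)\<^sup>2"
    using u v sym[OF v u]
    by (simp_all add: form_norm_squared scalar_prod_vec_simps[where d=d] mult_mat_vec_simps[OF carrier])
  then have "(form_norm (u + v))\<^sup>2 \<le> (form_norm u + form_norm v)\<^sup>2"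
    "(form_norm (u - v))\<^sup>2 \<le> (form_norm u + form_norm v)\<^sup>2"
    using * by (simp_all add: power2_sum)
  then show "form_norm (u + v) \<le> form_norm u + form_norm v" "form_norm (u - v) \<le> form_norm u + form_norm v"
    using form_norm_nonneg[OF u] form_norm_nonneg[OF v] by (auto intro: power2_le_imp_le)
qed

end

locale quadratic_objective = spd_matrix +
  fixes f :: "real vec \<Rightarrow> real" and b :: "real vec" and c :: real
  assumes b [simp]: "b \<in> carrier_vec d"
    and f_eq: "\<And>w. w \<in> carrier_vec d \<Longrightarrow> f w = c + b \<bullet> w + w \<bullet> (A *\<^sub>v w) / 2"
begin

lemma expansion:
  assumes w: "w \<in> carrier_vec d" and u: "u \<in> carrier_vec d"
  shows "f (w + u) = f w + (b + A *\<^sub>v w) \<bullet> u + u \<bullet> (A *\<^sub>v u) / 2"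
  using w u sym[OF w u]
  by (simp add: f_eq scalar_prod_vec_simps[where d=d] mult_mat_vec_simps[OF carrier]
      comm_scalar_prod[of "A *\<^sub>v w" d u] add_divide_distrib)

lemma grad_eq:
  assumes w: "w \<in> carrier_vec d"
  shows "grad d f w = b + A *\<^sub>v w"
proof (rule eq_vecI)
  fix k assume "k < dim_vec (b + A *\<^sub>v w)"
  with w have k: "k < d" using carrier by simp
  let ?e = "unit_vec d k :: real vec"
  have "f (w + t \<cdot>\<^sub>v ?e) = f w + t * ((b + A *\<^sub>v w) $ k) + t\<^sup>2 * (?e \<bullet> (A *\<^sub>v ?e)) / 2" for t
    using w k by (subst expansion) (simp_all add: mult_mat_vec_simps[OF carrier] scalar_prod_scale[where d=d] power2_eq_square
        del: scalar_prod_left_unit index_add_vec)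
  moreover have "((\<lambda>t. f w + t * ((b + A *\<^sub>v w) $ k) + t\<^sup>2 * (?e \<bullet> (A *\<^sub>v ?e)) / 2)
      has_field_derivative (b + A *\<^sub>v w) $ k) (at 0)"
    by (auto intro!: derivative_eq_intros)
  ultimately show "grad d f w $ k = (b + A *\<^sub>v w) $ k"
    using k by (simp add: grad_def DERIV_imp_deriv)
qed (use w carrier in \<open>simp add: grad_def\<close>)

lemma hess_eq:
  assumes w: "w \<in> carrier_vec d"
  shows "hess d f w = A"
proof (rule eq_matI)
  fix k l assume "k < dim_row A" "l < dim_col A"
  with carrier have k: "k < d" "l < d" by auto
  have "grad d f (w + t \<cdot>\<^sub>v unit_vec d l) $ k = (b + A *\<^sub>v w) $ k + t * A $$ (k, l)" for t
    using w k carrier carrier_vecD[OF b]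
    by (simp add: grad_eq mult_mat_vec_simps[OF carrier] del: index_mult_mat_vec) simp
  moreover have "((\<lambda>t. (b + A *\<^sub>v w) $ k + t * A $$ (k, l)) has_field_derivative A $$ (k, l)) (at 0)"
    by (auto intro!: derivative_eq_intros)
  ultimately show "hess d f w $$ (k, l) = A $$ (k, l)"
    using k by (simp add: hess_def DERIV_imp_deriv)
qed (use carrier in \<open>auto simp: hess_def\<close>)

definition minimizer where "minimizer = - (the (mat_inverse A) *\<^sub>v b)"

lemma minimizer_closed [simp]: "minimizer \<in> carrier_vec d"
  by (simp add: minimizer_def mat_inverse_mult)

lemma dim_minimizer [simp]: "dim_vec minimizer = d"
  by (rule carrier_vecD) simp

lemma grad_eq_minimizer:
  assumes w: "w \<in> carrier_vec d"
  shows "grad d f w = A *\<^sub>v (w - minimizer)"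
proof -
  have "w - minimizer = w + the (mat_inverse A) *\<^sub>v b"
    using w mat_inverse_mult(1)[OF b] by (intro eq_vecI) (auto simp: minimizer_def)
  then have "A *\<^sub>v (w - minimizer) = A *\<^sub>v w + b"
    using w by (simp add: mult_mat_vec_simps[OF carrier] mat_inverse_mult)
  then show ?thesis using w by (simp add: grad_eq comm_add_vec[where n=d])
qed

text \<open>Completing the square shows that the infimum is attained at \<open>minimizer\<close>.
  Accuracy and H-distance thus determine each other, and the iteration can be analysed through the
  distance alone.\<close>

lemma subopt_eq:
  assumes w: "w \<in> carrier_vec d"
  shows "subopt d f w = (form_norm (w - minimizer))\<^sup>2 / 2"
proof -
  have *: "f u = f minimizer + (form_norm (u - minimizer))\<^sup>2 / 2" if u: "u \<in> carrier_vec d" for u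
  proof -
    have "b + A *\<^sub>v minimizer = A *\<^sub>v (minimizer - minimizer)"
      using grad_eq grad_eq_minimizer by simp
    also have "\<dots> = 0\<^sub>v d" by (simp add: mult_mat_vec_simps[OF carrier])
    finally have z: "b + A *\<^sub>v minimizer = 0\<^sub>v d" .
    have "u = minimizer + (u - minimizer)"
      using u by (intro eq_vecI) auto
    then have "f u = f (minimizer + (u - minimizer))" by simp
    also have "\<dots> = f minimizer + (form_norm (u - minimizer))\<^sup>2 / 2"
      using u by (subst expansion) (simp_all add: z form_norm_squared)
    finally show ?thesis .
  qed
  have "(INF u\<in>carrier_vec d. f u) = f minimizer"
  proof (rule cInf_eq_minimum)
    fix y assume "y \<in> f ` carrier_vec d"
    then obtain u where u: "u \<in> carrier_vec d" "y = f u" by blast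
    then show "f minimizer \<le> y"
      using *[OF u(1)] zero_le_power2[of "form_norm (u - minimizer)"] by linarith
  qed simp
  with *[OF w] show ?thesis by (simp add: subopt_def)
qed

end

section \<open>Stopping indices\<close>

lemma first_index_eq_Least:
  assumes "P k"
  shows "first_index P = enat (LEAST k. P k)"
  unfolding first_index_def
proof (rule antisym)
  show "(INF k\<in>{k. P k}. enat k) \<le> enat (LEAST k. P k)"
    using LeastI[of P, OF assms] by (intro INF_lower) simp
  show "enat (LEAST k. P k) \<le> (INF k\<in>{k. P k}. enat k)"
    by (intro INF_greatest) (simp add: Least_le)
qed

text \<open>Some small residual within j * N steps bounds the first one passing the test, and the
  returned vector inherits that test. For g = 0 nothing is iterated and the residual is zero from
  the start.\<close>

lemma (in pcg_run) pcg_terminates: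
  assumes N: "2 * sqrt \<kappa> \<le> real N" "0 < N" and j: "0 < j"
    and tol: "0 \<le> \<epsilon>" "L / (l * 2 ^ j) * (norm2 g)\<^sup>2 \<le> \<epsilon>\<^sup>2"
  shows "pcg_iterations d H P g \<epsilon> \<le> enat (j * N)"
    and "pcg_result d H P g \<epsilon> \<in> carrier_vec d"
    and "norm2 (H *\<^sub>v (x - pcg_result d H P g \<epsilon>)) \<le> \<epsilon>"
proof -
  have "pcg_iterations d H P g \<epsilon> \<le> enat (j * N) \<and> pcg_result d H P g \<epsilon> \<in> carrier_vec d \<and>
    norm2 (H *\<^sub>v (x - pcg_result d H P g \<epsilon>)) \<le> \<epsilon>"
  proof (cases "g = 0\<^sub>v d")
    case True
    then have "pcg_iterations d H P g \<epsilon> = enat 0" by (simp add: pcg_iterations_def zero_enat_def)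
    then have "pcg_result d H P g \<epsilon> = v 0" by (simp only: pcg_result_def v_def the_enat.simps)
    moreover have "r 0 = 0\<^sub>v d" by (rule trans[OF step_0(2) True])
    then have "norm2 (r 0) = 0" by (simp add: norm2_def)
    ultimately show ?thesis
      using tol \<open>pcg_iterations d H P g \<epsilon> = enat 0\<close>
      by (simp only: closed residual[symmetric]) simp
  next
    case False
    let ?Q = "\<lambda>t. 1 \<le> t \<and> norm2 (r t) \<le> \<epsilon>"
    obtain t where t: "1 \<le> t" "t \<le> j * N" "(norm2 (r t))\<^sup>2 \<le> L / (l * 2 ^ j) * (norm2 g)\<^sup>2"
      using residual_geometric[OF N j False] by auto
    then have "(norm2 (r t))\<^sup>2 \<le> \<epsilon>\<^sup>2" using tol by linarith
    then have Q: "?Q t" using t tol power2_le_imp_le by blast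
    have iter: "pcg_iterations d H P g \<epsilon> = enat (LEAST t. ?Q t)"
      using False first_index_eq_Least[of ?Q, OF Q]
      by (simp add: pcg_iterations_def pcg_residual_def r_def)
    then have "pcg_result d H P g \<epsilon> = v (LEAST t. ?Q t)"
      by (simp add: pcg_result_def v_def)
    moreover have "?Q (LEAST t. ?Q t)" by (rule LeastI[of ?Q, OF Q])
    moreover have "(LEAST t. ?Q t) \<le> t" by (rule Least_le[of ?Q, OF Q])
    ultimately show ?thesis
      using iter t by (simp only: closed residual[symmetric]) simp
  qed
  then show "pcg_iterations d H P g \<epsilon> \<le> enat (j * N)"
    "pcg_result d H P g \<epsilon> \<in> carrier_vec d"
    "norm2 (H *\<^sub>v (x - pcg_result d H P g \<epsilon>)) \<le> \<epsilon>" by auto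
qed

lemma sum_enat_le:
  assumes "\<And>k. k < K \<Longrightarrow> h k \<le> enat c"
  shows "(\<Sum>k<K. h k) \<le> enat (K * c)"
  using assms
proof (induction K)
  case (Suc K)
  then have "(\<Sum>k<K. h k) + h K \<le> enat (K * c) + enat c"
    by (intro add_mono) simp_all
  then show ?case by (simp add: add.commute)
qed (simp add: zero_enat_def)

text \<open>One PCG run is budgeted as \<open>j\<close> blocks of \<open>N\<close> steps. The
  squared tolerance is l / (400 L) * |g|^2 with 400 = 20^2, and \<open>j\<close> blocks reach L / (l
  2^j) * |g|^2; comparing the two gives the condition on 2^j.\<close>

locale disco_run = quadratic_objective d H "average m fs" b c + H: spd_bounded d H l L + P: spd_matrix d P
  for d m :: nat and fs :: "nat \<Rightarrow> real vec \<Rightarrow> real" and H :: "real mat" and b :: "real vec" and c l L :: real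
    and P :: "real mat" +
  fixes \<mu> \<kappa> :: real and j N :: nat
  assumes precond: "\<And>w. w \<in> carrier_vec d \<Longrightarrow> newton_precond d fs \<mu> w = P"
    and H_le_P: "\<And>v. v \<in> carrier_vec d \<Longrightarrow> v \<bullet> (H *\<^sub>v v) \<le> v \<bullet> (P *\<^sub>v v)"
    and P_le_H: "\<And>v. v \<in> carrier_vec d \<Longrightarrow> v \<bullet> (P *\<^sub>v v) \<le> \<kappa> * (v \<bullet> (H *\<^sub>v v))"
    and l_le_L: "l \<le> L"
    and N: "2 * sqrt \<kappa> \<le> real N" "0 < N" and j: "0 < j" "400 * (L / l)\<^sup>2 \<le> 2 ^ j"
begin

section \<open>Contraction of the damped inexact Newton step\<close>

definition err where "err w = form_norm (w - minimizer)"

lemma err_nonneg: "w \<in> carrier_vec d \<Longrightarrow> 0 \<le> err w"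
  by (simp add: err_def form_norm_nonneg)

text \<open>The exact direction is w - \<open>minimizer\<close>. Passing between residuals and the
  H-norm costs sqrt (L / l), and the factor sqrt (l / L) in the tolerance cancels exactly this,
  leaving 1/20.\<close>

lemma newton:
  assumes w: "w \<in> carrier_vec d"
  shows "newton_pcg_iterations d m fs l L \<mu> w \<le> enat (j * N)"
    and "newton_direction d m fs l L \<mu> w \<in> carrier_vec d"
    and "form_norm ((w - minimizer) - newton_direction d m fs l L \<mu> w) \<le> err w / 20"
proof -
  have L: "0 < L" using l_le_L H.l_pos by simp
  define x where "x = w - minimizer"
  have x: "x \<in> carrier_vec d" using w by (simp add: x_def)
  define g where "g = H *\<^sub>v x"
  define \<epsilon> where "\<epsilon> = newton_tol d (average m fs) l L w"
  interpret pcg_run d H l L P \<kappa> g x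
    by unfold_locales (use H_le_P P_le_H x in \<open>auto simp: g_def\<close>)
  have gr: "grad d (average m fs) w = g" using w by (simp add: grad_eq_minimizer g_def x_def)
  then have \<epsilon>: "\<epsilon> = 1 / 20 * sqrt (l / L) * norm2 g" by (simp add: \<epsilon>_def newton_tol_def)
  then have \<epsilon>2: "\<epsilon>\<^sup>2 = l / (400 * L) * (norm2 g)\<^sup>2"
    unfolding \<epsilon> using L H.l_pos by (simp add: power_mult_distrib power_divide)
  have tol: "0 \<le> \<epsilon>" using L H.l_pos by (simp add: \<epsilon> norm2_nonneg)
  have tol2: "L / (l * 2 ^ j) * (norm2 g)\<^sup>2 \<le> \<epsilon>\<^sup>2"
  proof -
    have "L / (l * 2 ^ j) \<le> L / (l * (400 * (L / l)\<^sup>2))"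
      using L H.l_pos j by (intro divide_left_mono mult_left_mono mult_pos_pos) simp_all
    also have "\<dots> = l / (400 * L)"
      using L H.l_pos by (simp add: power2_eq_square field_simps)
    finally show ?thesis unfolding \<epsilon>2 by (rule mult_right_mono) simp
  qed
  note T = pcg_terminates[OF N j(1) tol tol2]
  have eqs: "newton_pcg_iterations d m fs l L \<mu> w = pcg_iterations d H P g \<epsilon>"
    "newton_direction d m fs l L \<mu> w = pcg_result d H P g \<epsilon>"
    using w by (simp_all add: newton_pcg_iterations_def newton_direction_def hess_eq precond gr \<epsilon>_def Let_def)
  show "newton_pcg_iterations d m fs l L \<mu> w \<le> enat (j * N)"
    "newton_direction d m fs l L \<mu> w \<in> carrier_vec d" using T by (simp_all add: eqs)
  define e where "e = x - pcg_result d H P g \<epsilon>"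
  have e: "e \<in> carrier_vec d" using T x by (simp add: e_def)
  have "l * (e \<bullet> (H *\<^sub>v e)) \<le> (norm2 (H *\<^sub>v e))\<^sup>2"
    using H.image_lower[OF e] by (simp add: norm2_squared)
  also have "\<dots> \<le> \<epsilon>\<^sup>2"
    using T(3) by (simp add: e_def power_mono norm2_nonneg)
  also have "\<dots> \<le> l / (400 * L) * (L * (x \<bullet> (H *\<^sub>v x)))"
    unfolding \<epsilon>2 using H.image_upper[OF x] L H.l_pos
    by (intro mult_left_mono) (simp_all add: g_def norm2_squared)
  also have "\<dots> = l * ((form_norm x)\<^sup>2 / 400)" using L x by (simp add: form_norm_squared)
  finally have "(form_norm e)\<^sup>2 \<le> (form_norm x / 20)\<^sup>2"
    using H.l_pos e by (simp add: form_norm_squared power_divide)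
  then have "form_norm e \<le> form_norm x / 20"
    by (rule power2_le_imp_le) (simp add: form_norm_nonneg x)
  then show "form_norm ((w - minimizer) - newton_direction d m fs l L \<mu> w) \<le> err w / 20"
    by (simp add: eqs e_def x_def err_def)
qed

text \<open>With k = 1 / (1 + \<delta>) the new error is the convex combination (1 - k) x + k (x -
  v), of norm at most (1 - 19/20 k) |x|. The triangle inequality gives \<delta> <= 21/20 |x|, which
  bounds k from below.\<close>

lemma disco_step:
  assumes w: "w \<in> carrier_vec d"
  shows "disco_step d m fs l L \<mu> w \<in> carrier_vec d"
    and "err (disco_step d m fs l L \<mu> w) \<le> (1 - (19 / 20) / (1 + 21 / 20 * err w)) * err w"
proof -
  define x where "x = w - minimizer"
  have x: "x \<in> carrier_vec d" using w by (simp add: x_def)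
  define v where "v = newton_direction d m fs l L \<mu> w"
  have v: "v \<in> carrier_vec d" by (simp add: v_def newton w)
  define \<delta> where "\<delta> = form_norm v"
  have \<delta>: "0 \<le> \<delta>" by (simp add: \<delta>_def form_norm_nonneg v)
  have step: "disco_step d m fs l L \<mu> w = w - (1 / (1 + \<delta>)) \<cdot>\<^sub>v v"
    using w by (simp add: disco_step_def hess_eq \<delta>_def form_norm_def v_def Let_def)
  then show "disco_step d m fs l L \<mu> w \<in> carrier_vec d" using w v by simp
  define D where "D = err w"
  have D: "D = form_norm x" "0 \<le> D" using w by (simp_all add: D_def err_def x_def err_nonneg form_norm_nonneg)
  have e: "form_norm (x - v) \<le> D / 20" using newton(3)[OF w] by (simp add: x_def v_def D_def)
  have "v = x - (x - v)" using x v by (intro eq_vecI) auto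
  then have "\<delta> = form_norm (x - (x - v))" by (simp add: \<delta>_def)
  also have "\<dots> \<le> form_norm x + form_norm (x - v)" using x v by (intro form_norm_triangle) simp_all
  finally have \<delta>_le: "\<delta> \<le> 21 / 20 * D" using e D by simp
  define k where "k = 1 / (1 + \<delta>)"
  have k: "0 \<le> k" "k \<le> 1" using \<delta> by (simp_all add: k_def)
  have "disco_step d m fs l L \<mu> w - minimizer = (1 - k) \<cdot>\<^sub>v x + k \<cdot>\<^sub>v (x - v)"
  proof (rule eq_vecI)
    fix i assume "i < dim_vec ((1 - k) \<cdot>\<^sub>v x + k \<cdot>\<^sub>v (x - v))"
    then have "i < d" using x v by simp
    then show "(disco_step d m fs l L \<mu> w - minimizer) $ i = ((1 - k) \<cdot>\<^sub>v x + k \<cdot>\<^sub>v (x - v)) $ i"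
      using w carrier_vecD[OF v] by (simp add: step x_def k_def[symmetric] algebra_simps)
  qed (use x v w in \<open>simp add: step\<close>)
  then have "err (disco_step d m fs l L \<mu> w) \<le> form_norm ((1 - k) \<cdot>\<^sub>v x) + form_norm (k \<cdot>\<^sub>v (x - v))"
    unfolding err_def using x v by (simp add: form_norm_triangle)
  also have "\<dots> = (1 - k) * D + k * form_norm (x - v)"
    using x v k D by (simp add: form_norm_scale)
  also have "\<dots> \<le> (1 - k) * D + k * (D / 20)"
    using k by (intro add_left_mono mult_left_mono e) simp
  also have "\<dots> = (1 - 19 / 20 * k) * D" by (simp add: algebra_simps)
  also have "\<dots> \<le> (1 - 19 / 20 * (1 / (1 + 21 / 20 * D))) * D"
    unfolding k_def using \<delta>_le \<delta> D
    by (intro mult_right_mono diff_left_mono mult_left_mono divide_left_mono) simp_all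
  finally show "err (disco_step d m fs l L \<mu> w) \<le> (1 - (19 / 20) / (1 + 21 / 20 * err w)) * err w"
    by (simp add: D_def)
qed

text \<open>The one-step factor increases with the current error, and errors never grow, so the
  factor of the starting point remains valid throughout.\<close>

lemma iterates:
  assumes w: "w \<in> carrier_vec d"
  shows "(disco_step d m fs l L \<mu> ^^ k) w \<in> carrier_vec d \<and>
    err ((disco_step d m fs l L \<mu> ^^ k) w) \<le> (1 - (19 / 20) / (1 + 21 / 20 * err w)) ^ k * err w"
proof (induction k)
  case 0
  show ?case using w by simp
next
  case (Suc k)
  let ?q = "1 - (19 / 20) / (1 + 21 / 20 * err w)" and ?w = "(disco_step d m fs l L \<mu> ^^ k) w"
  have wk: "?w \<in> carrier_vec d" using Suc by simp
  have D: "0 \<le> err w" by (rule err_nonneg[OF w])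
  have q: "0 \<le> ?q" "?q \<le> 1" using D by (simp_all add: field_simps)
  have "?q ^ k * err w \<le> 1 * err w" using q D by (intro mult_right_mono power_le_one) simp_all
  then have le: "err ?w \<le> err w" using Suc by simp
  have "err (disco_step d m fs l L \<mu> ?w) \<le> (1 - (19 / 20) / (1 + 21 / 20 * err ?w)) * err ?w"
    by (rule disco_step[OF wk])
  also have "\<dots> \<le> ?q * err ?w"
    using le err_nonneg[OF wk] D
    by (intro mult_right_mono diff_left_mono divide_left_mono mult_pos_pos) simp_all
  also have "\<dots> \<le> ?q * (?q ^ k * err w)" using q Suc by (intro mult_left_mono) simp_all
  finally show ?case using disco_step(1)[OF wk] by (simp add: mult.assoc)
qed

text \<open>Each step multiplies the gap by at most exp(-1 / (1 + G)), G being the initial gap.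
  About (1 + G) ln (G / \<epsilon>) steps suffice, and ln G <= G turns this into (1 + G)^2 times the
  logarithm of 1 / \<epsilon>.\<close>

lemma subopt_iterate:
  assumes w: "w \<in> carrier_vec d" and \<epsilon>: "0 < \<epsilon>"
    and k: "(1 + subopt d (average m fs) w)\<^sup>2 * ln1 (1 / \<epsilon>) \<le> real k"
  shows "subopt d (average m fs) ((disco_step d m fs l L \<mu> ^^ k) w) \<le> \<epsilon>"
proof -
  define D where "D = err w"
  define G where "G = subopt d (average m fs) w"
  define wk where "wk = (disco_step d m fs l L \<mu> ^^ k) w"
  define q where "q = 1 - (19 / 20) / (1 + 21 / 20 * D)"
  have D: "0 \<le> D" by (simp add: D_def err_nonneg w)
  have G: "G = D\<^sup>2 / 2" "0 \<le> G" using w by (simp_all add: G_def D_def subopt_eq err_def)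
  have q: "0 \<le> q" using D by (simp add: q_def field_simps)
  have wk: "wk \<in> carrier_vec d" "err wk \<le> q ^ k * D"
    using iterates[OF w, of k] by (simp_all add: wk_def q_def D_def)
  have "(err wk)\<^sup>2 \<le> (q ^ k * D)\<^sup>2" using wk err_nonneg by (intro power_mono) auto
  also have "(q ^ k * D)\<^sup>2 = (q\<^sup>2) ^ k * (2 * G)"
    using G by (simp add: power_mult_distrib mult.commute flip: power_mult)
  finally have sub: "subopt d (average m fs) wk \<le> (q\<^sup>2) ^ k * G"
    using wk by (simp add: subopt_eq err_def)
  define a where "a = (19 / 20) / (1 + 21 / 20 * D)"
  \<comment> \<open>From 2 D <= 1 + D^2 and D^2 = 2 G; the target constant 19/10 is twice the 19/20
    in \<open>a\<close>, since the gap is quadratic in the distance.\<close>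
  have "21 / 10 * D \<le> 21 / 20 * (1 + D\<^sup>2)" using sum_squares_bound[of 1 D] by simp
  then have "1 + 21 / 20 * D \<le> 19 / 10 * (1 + G)" using D G by simp
  then have "1 / (1 + G) \<le> 2 * a"
    using D G by (simp add: a_def divide_simps)
  moreover have "q \<le> exp (- a)"
    unfolding q_def using exp_ge_add_one_self[of "- a"] by (simp add: a_def)
  then have "q\<^sup>2 \<le> (exp (- a))\<^sup>2" using q by (rule power_mono)
  then have "q\<^sup>2 \<le> exp (- (2 * a))" using exp_double[of "- a"] by simp
  ultimately have "q\<^sup>2 \<le> exp (- (1 / (1 + G)))"
    by (meson exp_le_cancel_iff neg_le_iff_le order_trans)
  then have "(q\<^sup>2) ^ k \<le> exp (- (1 / (1 + G))) ^ k" by (intro power_mono) simp_all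
  then have "(q\<^sup>2) ^ k * G \<le> exp (- (real k / (1 + G))) * G"
    using G(2) by (intro mult_right_mono) (simp_all flip: exp_of_nat_mult)
  also have "\<dots> \<le> \<epsilon>"
  proof (cases "G = 0")
    case False
    then have Gp: "0 < G" using G(2) by simp
    define a where "a = ln1 (1 / \<epsilon>)"
    have a: "1 \<le> a" "ln (1 / \<epsilon>) \<le> a" by (simp_all add: a_def ln1_def)
    have "ln G + ln (1 / \<epsilon>) \<le> G * 1 + a" using ln_bound[OF Gp] a by simp
    also have "\<dots> \<le> G * a + a" using a G(2) by (intro add_right_mono mult_left_mono) simp_all
    also have "\<dots> = (1 + G)\<^sup>2 * a / (1 + G)" using G(2) by (simp add: power2_eq_square field_simps)
    also have "\<dots> \<le> real k / (1 + G)" using k G(2) by (intro divide_right_mono) (simp_all add: a_def G_def)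
    finally have "ln G - real k / (1 + G) \<le> ln \<epsilon>" using \<epsilon> by (simp add: ln_div)
    then have "exp (ln G - real k / (1 + G)) \<le> \<epsilon>" using \<epsilon> by (metis exp_le_cancel_iff exp_ln)
    then show ?thesis using Gp by (simp add: exp_diff exp_minus divide_inverse mult.commute)
  qed (use \<epsilon> in simp)
  finally show ?thesis using sub by (simp add: wk_def)
qed

lemma disco_rounds_le:
  assumes w: "init_point d m fs ini \<in> carrier_vec d" and \<epsilon>: "0 < \<epsilon>"
    and K: "(1 + subopt d (average m fs) (init_point d m fs ini))\<^sup>2 * ln1 (1 / \<epsilon>) \<le> real K"
  shows "disco_rounds d m fs l L \<mu> ini \<epsilon> \<le> enat (1 + K * (1 + j * N))"
proof -
  let ?w = "disco_iterate d m fs l L \<mu> ini"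
  let ?Q = "\<lambda>k. subopt d (average m fs) (?w k) \<le> \<epsilon>"
  have Q: "?Q K" unfolding disco_iterate_def by (rule subopt_iterate[OF w \<epsilon> K])
  define K' where "K' = (LEAST k. ?Q k)"
  have K': "K' \<le> K" unfolding K'_def by (rule Least_le[of ?Q, OF Q])
  have closed: "?w k \<in> carrier_vec d" for k using iterates[OF w, of k] by (simp add: disco_iterate_def)
  have "init_rounds ini \<le> 1" by (cases ini) simp_all
  moreover have "1 + newton_pcg_iterations d m fs l L \<mu> (?w k) \<le> enat (1 + j * N)" for k
    using add_left_mono[OF newton(1)[OF closed[of k]], of "enat 1"] by (simp add: one_enat_def)
  then have "(\<Sum>k<K'. 1 + newton_pcg_iterations d m fs l L \<mu> (?w k)) \<le> enat (K' * (1 + j * N))"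
    by (intro sum_enat_le)
  ultimately have "enat (init_rounds ini) + (\<Sum>k<K'. 1 + newton_pcg_iterations d m fs l L \<mu> (?w k))
      \<le> enat 1 + enat (K' * (1 + j * N))"
    by (intro add_mono) simp_all
  also have "\<dots> = enat (1 + K' * (1 + j * N))" by simp
  also have "\<dots> \<le> enat (1 + K * (1 + j * N))"
    using mult_le_mono1[OF K', of "1 + j * N"] by simp
  finally show ?thesis
    by (simp add: disco_rounds_def first_index_eq_Least[of ?Q, OF Q] K'_def Let_def)
qed

end

section \<open>Weighted least squares\<close>

text \<open>Hessian of a weighted least-squares objective. Arbitrary weights let the master Hessian
  and the full Hessian share one index set, so their difference is linear in the difference of the
  weights.\<close>

definition weighted_gram :: "nat \<Rightarrow> 'p set \<Rightarrow> ('p \<Rightarrow> real) \<Rightarrow> ('p \<Rightarrow> real vec) \<Rightarrow> real \<Rightarrow> real mat" where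
  "weighted_gram d I \<theta> x lam =
    mat d d (\<lambda>(k, l). 2 * (\<Sum>p\<in>I. \<theta> p * (x p $ k * x p $ l)) + (if k = l then lam else 0))"

lemma weighted_gram_carrier [simp]: "weighted_gram d I \<theta> x lam \<in> carrier_mat d d"
  by (simp add: weighted_gram_def)

lemma weighted_gram_form:
  assumes u: "u \<in> carrier_vec d" and v: "v \<in> carrier_vec d" and x: "\<And>p. p \<in> I \<Longrightarrow> x p \<in> carrier_vec d"
  shows "u \<bullet> (weighted_gram d I \<theta> x lam *\<^sub>v v) =
    2 * (\<Sum>p\<in>I. \<theta> p * ((u \<bullet> x p) * (v \<bullet> x p))) + lam * (u \<bullet> v)"
proof -
  have ux: "w \<bullet> x p = (\<Sum>k=0..<d. w $ k * x p $ k)" if "p \<in> I" for w p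
    using x[OF that] by (simp add: scalar_prod_def)
  have "u \<bullet> (weighted_gram d I \<theta> x lam *\<^sub>v v) =
    (\<Sum>k=0..<d. \<Sum>l=0..<d. u $ k *
      ((2 * (\<Sum>p\<in>I. \<theta> p * (x p $ k * x p $ l)) + (if k = l then lam else 0)) * v $ l))"
    using u v by (simp add: scalar_prod_def weighted_gram_def sum_distrib_left)
  also have "\<dots> = (\<Sum>k=0..<d. \<Sum>l=0..<d. 2 * (\<Sum>p\<in>I. \<theta> p * ((u $ k * x p $ k) * (v $ l * x p $ l))))
      + (\<Sum>k=0..<d. \<Sum>l=0..<d. if k = l then lam * (u $ k * v $ l) else 0)"
    unfolding sum.distrib[symmetric]
    by (intro sum.cong refl) (auto simp: distrib_left distrib_right sum_distrib_left sum_distrib_right mult_ac)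
  also have "(\<Sum>k=0..<d. \<Sum>l=0..<d. if k = l then lam * (u $ k * v $ l) else 0) = lam * (u \<bullet> v)"
    using v by (simp add: scalar_prod_def sum_distrib_left)
  also have "(\<Sum>k=0..<d. \<Sum>l=0..<d. 2 * (\<Sum>p\<in>I. \<theta> p * ((u $ k * x p $ k) * (v $ l * x p $ l))))
      = 2 * (\<Sum>k=0..<d. \<Sum>p\<in>I. \<Sum>l=0..<d. \<theta> p * ((u $ k * x p $ k) * (v $ l * x p $ l)))"
    by (simp only: sum_distrib_left[where r="2::real", symmetric] sum.swap[of _ I "{0..<d}"])
  also have "\<dots> = 2 * (\<Sum>p\<in>I. \<theta> p * (\<Sum>k=0..<d. \<Sum>l=0..<d. (u $ k * x p $ k) * (v $ l * x p $ l)))"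
    by (subst sum.swap) (simp add: sum_distrib_left)
  also have "(\<Sum>p\<in>I. \<theta> p * (\<Sum>k=0..<d. \<Sum>l=0..<d. (u $ k * x p $ k) * (v $ l * x p $ l)))
      = (\<Sum>p\<in>I. \<theta> p * ((u \<bullet> x p) * (v \<bullet> x p)))"
    by (simp add: ux sum_product)
  finally show ?thesis .
qed

text \<open>Here \<open>B\<close> bounds squared norms; it is instantiated by the square of the
  radius. Total weight 1 makes the upper spectral bound lam + 2 B the same for every choice of
  weights.\<close>

locale weighted_least_squares =
  fixes d :: nat and I :: "'p set" and \<theta> y :: "'p \<Rightarrow> real" and x :: "'p \<Rightarrow> real vec" and lam B :: real
  assumes x: "\<And>p. p \<in> I \<Longrightarrow> x p \<in> carrier_vec d" "\<And>p. p \<in> I \<Longrightarrow> x p \<bullet> x p \<le> B"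
    and \<theta>: "\<And>p. p \<in> I \<Longrightarrow> 0 \<le> \<theta> p" "(\<Sum>p\<in>I. \<theta> p) = 1"
    and lam: "0 < lam"
begin

definition objective where
  "objective w = (\<Sum>p\<in>I. \<theta> p * (y p - w \<bullet> x p)\<^sup>2) + lam / 2 * (norm2 w)\<^sup>2"

lemmas form = weighted_gram_form[of _ d _ I x, OF _ _ x(1)]

lemma lower:
  assumes v: "v \<in> carrier_vec d"
  shows "lam * (v \<bullet> v) \<le> v \<bullet> (weighted_gram d I \<theta> x lam *\<^sub>v v)"
  using \<theta> by (simp add: form v sum_nonneg)

sublocale spd_matrix d "weighted_gram d I \<theta> x lam"
proof unfold_locales
  fix u v :: "real vec" assume "u \<in> carrier_vec d" "v \<in> carrier_vec d"
  then show "u \<bullet> (weighted_gram d I \<theta> x lam *\<^sub>v v) = v \<bullet> (weighted_gram d I \<theta> x lam *\<^sub>v u)"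
    by (simp add: form comm_scalar_prod[of u d v] mult.commute)
next
  fix v :: "real vec" assume v: "v \<in> carrier_vec d" "v \<noteq> 0\<^sub>v d"
  then have "0 < lam * (v \<bullet> v)" using lam scalar_prod_self_pos[of v d] by simp
  then show "0 < v \<bullet> (weighted_gram d I \<theta> x lam *\<^sub>v v)" using lower[OF v(1)] by simp
qed simp

lemma upper:
  assumes v: "v \<in> carrier_vec d"
  shows "v \<bullet> (weighted_gram d I \<theta> x lam *\<^sub>v v) \<le> (lam + 2 * B) * (v \<bullet> v)"
proof -
  interpret I: spd_matrix d "1\<^sub>m d" by (rule spd_one)
  have "(v \<bullet> x p) * (v \<bullet> x p) \<le> (v \<bullet> v) * B" if p: "p \<in> I" for p
  proof -
    have "(v \<bullet> x p)\<^sup>2 \<le> (v \<bullet> v) * (x p \<bullet> x p)"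
      using I.cauchy_schwarz[OF v x(1)[OF p]] v x(1)[OF p] by simp
    also have "\<dots> \<le> (v \<bullet> v) * B"
      by (intro mult_left_mono x p scalar_prod_self_nonneg)
    finally show ?thesis by (simp add: power2_eq_square)
  qed
  then have "(\<Sum>p\<in>I. \<theta> p * ((v \<bullet> x p) * (v \<bullet> x p))) \<le> (\<Sum>p\<in>I. \<theta> p * ((v \<bullet> v) * B))"
    using \<theta> by (intro sum_mono mult_left_mono) auto
  also have "\<dots> = (v \<bullet> v) * B"
    using \<theta> by (simp flip: sum_distrib_right)
  finally show ?thesis by (simp add: form v algebra_simps)
qed

sublocale spd_bounded d "weighted_gram d I \<theta> x lam" lam "lam + 2 * B"
  by unfold_locales (simp_all add: lam lower upper)

lemma quadratic:
  assumes f: "\<And>w. w \<in> carrier_vec d \<Longrightarrow> f w = objective w"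
  shows "quadratic_objective d (weighted_gram d I \<theta> x lam) f
    (vec d (\<lambda>k. - 2 * (\<Sum>p\<in>I. \<theta> p * y p * x p $ k))) (\<Sum>p\<in>I. \<theta> p * (y p)\<^sup>2)"
proof unfold_locales
  fix w :: "real vec" assume w: "w \<in> carrier_vec d"
  have wx: "w \<bullet> x p = (\<Sum>k=0..<d. w $ k * x p $ k)" if "p \<in> I" for p
    using x(1)[OF that] by (simp add: scalar_prod_def)
  have "vec d (\<lambda>k. - 2 * (\<Sum>p\<in>I. \<theta> p * y p * x p $ k)) \<bullet> w =
      (\<Sum>k=0..<d. \<Sum>p\<in>I. - 2 * (\<theta> p * y p * (w $ k * x p $ k)))"
    using w by (simp add: scalar_prod_def sum_distrib_left sum_distrib_right mult_ac sum_negf)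
  also have "\<dots> = (\<Sum>p\<in>I. - 2 * (\<theta> p * y p * (w \<bullet> x p)))"
    by (subst sum.swap) (simp add: wx sum_distrib_left)
  finally have b: "vec d (\<lambda>k. - 2 * (\<Sum>p\<in>I. \<theta> p * y p * x p $ k)) \<bullet> w =
      (\<Sum>p\<in>I. - 2 * (\<theta> p * y p * (w \<bullet> x p)))" .
  have "(\<Sum>p\<in>I. \<theta> p * (y p - w \<bullet> x p)\<^sup>2) = (\<Sum>p\<in>I. \<theta> p * (y p)\<^sup>2)
      + (\<Sum>p\<in>I. - 2 * (\<theta> p * y p * (w \<bullet> x p))) + (\<Sum>p\<in>I. \<theta> p * ((w \<bullet> x p) * (w \<bullet> x p)))"
    by (simp add: sum.distrib[symmetric] power2_eq_square algebra_simps del: sum.distrib)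
  then show "f w = (\<Sum>p\<in>I. \<theta> p * (y p)\<^sup>2) + vec d (\<lambda>k. - 2 * (\<Sum>p\<in>I. \<theta> p * y p * x p $ k)) \<bullet> w
      + w \<bullet> (weighted_gram d I \<theta> x lam *\<^sub>v w) / 2"
    unfolding b f[OF w] objective_def norm2_squared by (simp add: form w add_divide_distrib)
qed simp

end

text \<open>The Frobenius norm of v v^T is |v|^2. It serves both to bound the random vectors and to
  estimate quadratic forms.\<close>

lemma sum_outer_product_squared:
  fixes v :: "real vec"
  assumes "v \<in> carrier_vec d"
  shows "(\<Sum>q\<in>{..<d} \<times> {..<d}. (v $ fst q * v $ snd q)\<^sup>2) = (v \<bullet> v)\<^sup>2"
  using assms
  by (simp add: scalar_prod_def power2_eq_square sum_product sum.cartesian_product lessThan_atLeast0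
      mult_ac case_prod_unfold)

text \<open>The quadratic form of S at v is the Frobenius inner product of S with v v^T, so
  Cauchy-Schwarz over index pairs applies.\<close>

lemma frobenius_bound:
  fixes S :: "nat \<times> nat \<Rightarrow> real"
  assumes "v \<in> carrier_vec d" "(\<Sum>q\<in>{..<d} \<times> {..<d}. (S q)\<^sup>2) \<le> \<mu>\<^sup>2" "0 \<le> \<mu>"
  shows "\<bar>\<Sum>q\<in>{..<d} \<times> {..<d}. S q * (v $ fst q * v $ snd q)\<bar> \<le> \<mu> * (v \<bullet> v)"
proof -
  let ?J = "{..<d} \<times> {..<d}"
  have "(\<Sum>q\<in>?J. S q * (v $ fst q * v $ snd q))\<^sup>2 \<le> (\<Sum>q\<in>?J. (S q)\<^sup>2) * (v \<bullet> v)\<^sup>2"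
    using Cauchy_Schwarz_ineq_sum[of S "\<lambda>q. v $ fst q * v $ snd q" ?J] sum_outer_product_squared[OF assms(1)]
    by simp
  also have "\<dots> \<le> \<mu>\<^sup>2 * (v \<bullet> v)\<^sup>2" using assms by (intro mult_right_mono) simp_all
  finally have "(\<Sum>q\<in>?J. S q * (v $ fst q * v $ snd q))\<^sup>2 \<le> (\<mu> * (v \<bullet> v))\<^sup>2"
    by (simp add: power_mult_distrib)
  then show ?thesis
    using assms(3) by (simp add: abs_le_square_iff[symmetric] abs_mult scalar_prod_self_nonneg)
qed

lemma weighted_gram_diff:
  fixes x :: "'p \<Rightarrow> real vec"
  assumes v: "v \<in> carrier_vec d" and x: "\<And>p. p \<in> I \<Longrightarrow> x p \<in> carrier_vec d"
  shows "v \<bullet> (weighted_gram d I \<theta> x lam *\<^sub>v v) - v \<bullet> (weighted_gram d I \<theta>' x lam *\<^sub>v v) =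
    (\<Sum>q\<in>{..<d} \<times> {..<d}. (\<Sum>p\<in>I. (\<theta> p - \<theta>' p) * (2 * (x p $ fst q * x p $ snd q))) * (v $ fst q * v $ snd q))"
proof -
  have "(v \<bullet> x p) * (v \<bullet> x p) = (\<Sum>q\<in>{..<d} \<times> {..<d}. (x p $ fst q * x p $ snd q) * (v $ fst q * v $ snd q))"
    if "p \<in> I" for p
    using v x[OF that]
    by (simp add: scalar_prod_def sum_product sum.cartesian_product lessThan_atLeast0 mult_ac case_prod_unfold)
  then have *: "(\<theta> p - \<theta>' p) * (2 * ((v \<bullet> x p) * (v \<bullet> x p))) =
      (\<Sum>q\<in>{..<d} \<times> {..<d}. (\<theta> p - \<theta>' p) * (2 * (x p $ fst q * x p $ snd q)) * (v $ fst q * v $ snd q))"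
    if "p \<in> I" for p
    using that by (simp add: sum_distrib_left mult.assoc)
  have "v \<bullet> (weighted_gram d I \<theta> x lam *\<^sub>v v) - v \<bullet> (weighted_gram d I \<theta>' x lam *\<^sub>v v) =
      (\<Sum>p\<in>I. (\<theta> p - \<theta>' p) * (2 * ((v \<bullet> x p) * (v \<bullet> x p))))"
    using v x by (simp add: weighted_gram_form sum_distrib_left algebra_simps flip: sum_subtractf)
  also have "\<dots> = (\<Sum>q\<in>{..<d} \<times> {..<d}. \<Sum>p\<in>I.
      (\<theta> p - \<theta>' p) * (2 * (x p $ fst q * x p $ snd q)) * (v $ fst q * v $ snd q))"
    by (subst sum.swap) (simp add: *)
  finally show ?thesis by (simp only: sum_distrib_right)
qed

section \<open>Round counts for ridge regression\<close>

lemma ln1_ge: "1 \<le> ln1 x" "ln x \<le> ln1 x"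
  by (simp_all add: ln1_def)

text \<open>\<mu> carries only the square root of ln t; enlarging it to \<open>ln1 t\<close>, and 32
  to 36, makes the radicands perfect squares.\<close>

lemma sqrt_condition_bound:
  fixes B lam L \<mu> t :: real and d n :: nat
  assumes dn: "1 \<le> d" "1 \<le> n" and lam: "0 < lam" and B: "0 \<le> B" and L: "L = lam + 2 * B\<^sup>2"
    and t: "1 \<le> t"
    and \<mu>: "\<mu> = sqrt (32 * L\<^sup>2 * real d / real n) * sqrt (ln t / real d)"
  shows "sqrt (1 + 2 * \<mu> / lam) \<le> 5 * ln1 t * (1 + B / (sqrt lam * root 4 (real n)))"
proof -
  define a Y where "a = ln1 t" and "Y = B / (sqrt lam * root 4 (real n))"
  have a: "1 \<le> a" "ln t \<le> a" "0 \<le> ln t" using t by (simp_all add: a_def ln1_ge)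
  have n: "1 \<le> sqrt (real n)" using dn by simp
  have L_pos: "0 < L" using lam by (simp add: L add_pos_nonneg)
  have r: "(root 4 (real n))\<^sup>2 = sqrt (real n)"
    by (rule real_sqrt_unique[symmetric]) (simp_all flip: power_mult)
  have Y: "0 \<le> Y" "Y\<^sup>2 = B\<^sup>2 / (lam * sqrt (real n))"
    using B lam by (simp_all add: Y_def power_divide power_mult_distrib r)
  have "\<mu> = sqrt (32 * L\<^sup>2 * ln t / real n)"
    using dn by (simp add: \<mu> flip: real_sqrt_mult)
  also have "\<dots> \<le> sqrt ((6 * L * a)\<^sup>2 / real n)"
  proof -
    have "ln t \<le> a * a" using a mult_mono[of 1 a "ln t" a] by simp
    then have "32 * L\<^sup>2 * ln t \<le> 36 * L\<^sup>2 * (a * a)" using a by (intro mult_mono) simp_all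
    then show ?thesis using dn by (simp add: power2_eq_square divide_right_mono mult_ac)
  qed
  also have "\<dots> = 6 * L * a / sqrt (real n)" using L_pos a by (simp add: real_sqrt_divide)
  finally have "2 * \<mu> / lam \<le> 2 * (6 * L * a / sqrt (real n)) / lam"
    using lam by (intro divide_right_mono) simp_all
  \<comment> \<open>Splitting L = lam + 2 B^2 gives L / (lam sqrt n) = 1 / sqrt n + 2 Y^2; the
    fourth root in Y arises from this square.\<close>
  also have "\<dots> = 12 * a * (1 / sqrt (real n) + 2 * Y\<^sup>2)"
    using lam n by (simp add: L Y field_simps)
  also have "\<dots> \<le> 12 * a * (1 + 2 * Y\<^sup>2)"
    using a n by (intro mult_left_mono) simp_all
  finally have "1 + 2 * \<mu> / lam \<le> a * (13 + 24 * Y\<^sup>2)"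
    using a by (simp add: algebra_simps)
  also have "\<dots> \<le> (a * a) * (25 * (1 + Y)\<^sup>2)"
    using a Y(1) by (intro mult_mono) (simp_all add: power2_sum add_nonneg_nonneg)
  also have "\<dots> = (5 * a * (1 + Y))\<^sup>2" by (simp add: power2_eq_square algebra_simps)
  finally have "sqrt (1 + 2 * \<mu> / lam) \<le> sqrt ((5 * a * (1 + Y))\<^sup>2)"
    by (simp only: real_sqrt_le_iff)
  also have "\<dots> = 5 * a * (1 + Y)" using a Y(1) by simp
  finally show ?thesis by (simp add: a_def Y_def)
qed

lemma exists_halvings:
  fixes s :: real
  assumes s: "1 \<le> s"
  shows "\<exists>j. 0 < j \<and> 400 * s\<^sup>2 \<le> 2 ^ j \<and> real j \<le> 13 * ln1 s"
proof -
  \<comment> \<open>log 2 400 <= 9, log 2 (s^2) <= 3 ln s because ln 2 >= 2/3, and rounding up adds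
    1: in total 10 + 3 ln s <= 13 * \<open>ln1 s\<close>.\<close>
  define j where "j = nat \<lceil>log 2 (400 * s\<^sup>2)\<rceil>"
  have "log 2 400 \<le> log 2 (2 ^ 9)" by (subst log_le_cancel_iff) simp_all
  then have "log 2 400 \<le> 9" by (simp del: power_numeral add: log_nat_power)
  moreover have "log 2 (s\<^sup>2) \<le> 3 * ln s"
  proof -
    have "2 / 3 \<le> ln (2 :: real)" by (rule ln2_ge_two_thirds)
    then have "3 * ln s * (2 / 3) \<le> 3 * ln s * ln 2" using s by (intro mult_left_mono) simp_all
    then show ?thesis using s by (simp add: log_def ln_realpow divide_le_eq)
  qed
  moreover have "log 2 (400 * s\<^sup>2) = log 2 400 + log 2 (s\<^sup>2)"
    using s by (simp add: log_mult)
  ultimately have up: "log 2 (400 * s\<^sup>2) \<le> 9 + 3 * ln s" by simp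
  have "1 \<le> s\<^sup>2" using s by simp
  then have "2 \<le> 400 * s\<^sup>2" by simp
  then have low: "1 \<le> log 2 (400 * s\<^sup>2)"
    by (subst one_le_log_cancel_iff) linarith+
  have j: "real j = of_int \<lceil>log 2 (400 * s\<^sup>2)\<rceil>" using low by (simp add: j_def)
  have "real j \<le> 10 + 3 * ln s" using up unfolding j by linarith
  moreover have "10 + 3 * ln s \<le> 13 * ln1 s" using ln1_ge[of s] by linarith
  moreover have jl: "log 2 (400 * s\<^sup>2) \<le> real j" unfolding j by simp
  then have "400 * s\<^sup>2 \<le> 2 powr real j"
    using s by (subst (asm) log_le_iff) simp_all
  moreover have "0 < j" using low jl by (cases j) auto
  ultimately show ?thesis by (intro exI[of _ j]) (simp add: powr_realpow)
qed

text \<open>Rounding gives N <= 3 sqrt \<kappa> and 1 + K <= 3 (1 + g)^2 a. With j <= 13 *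
  \<open>ln1 s\<close> one gets 1 + j N <= (1 + 39) * \<open>ln1 s\<close> * sqrt \<kappa>, and 600
  = 3 * 40 * 5, the 5 coming from the bound on sqrt \<kappa>.\<close>

lemma exists_round_count:
  fixes \<kappa> s g a b Y :: real
  assumes \<kappa>: "1 \<le> \<kappa>" "sqrt \<kappa> \<le> 5 * b * (1 + Y)" and s: "1 \<le> s" and g: "0 \<le> g"
    and a: "1 \<le> a" and b: "1 \<le> b" and Y: "0 \<le> Y"
  shows "\<exists>j N K. 0 < j \<and> 400 * s\<^sup>2 \<le> 2 ^ j \<and> 0 < N \<and> 2 * sqrt \<kappa> \<le> real N \<and>
    (1 + g)\<^sup>2 * a \<le> real K \<and>
    real (1 + K * (1 + j * N)) \<le> 600 * (1 + g)\<^sup>2 * (1 + Y) * a * b * ln1 s"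
proof -
  obtain j where j: "0 < j" "400 * s\<^sup>2 \<le> 2 ^ j" "real j \<le> 13 * ln1 s"
    using exists_halvings[OF s] by auto
  define N K where "N = nat \<lceil>2 * sqrt \<kappa>\<rceil>" and "K = nat \<lceil>(1 + g)\<^sup>2 * a\<rceil>"
  have sk: "1 \<le> sqrt \<kappa>" using \<kappa> by simp
  have N: "2 * sqrt \<kappa> \<le> real N" "real N \<le> 3 * sqrt \<kappa>" using sk unfolding N_def by linarith+
  have N_pos: "0 < N" using N(1) sk by (cases N) auto
  have "1 * 1 \<le> (1 + g)\<^sup>2 * a" using g a by (intro mult_mono) (simp_all add: power2_sum)
  then have ga: "1 \<le> (1 + g)\<^sup>2 * a" by simp
  have K: "(1 + g)\<^sup>2 * a \<le> real K" "1 + real K \<le> 3 * ((1 + g)\<^sup>2 * a)"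
    using ga unfolding K_def by linarith+
  have \<ell>: "1 \<le> ln1 s" by (rule ln1_ge)
  have "real j * real N \<le> (13 * ln1 s) * (3 * sqrt \<kappa>)"
    using j N sk \<ell> by (intro mult_mono) simp_all
  moreover have "1 * 1 \<le> ln1 s * sqrt \<kappa>" using \<ell> sk by (intro mult_mono) simp_all
  ultimately have "1 + real j * real N \<le> 40 * (ln1 s * sqrt \<kappa>)" by simp
  also have "\<dots> \<le> 40 * (ln1 s * (5 * b * (1 + Y)))" using \<ell> \<kappa> by (intro mult_left_mono) simp_all
  finally have jN: "1 + real j * real N \<le> 200 * (ln1 s * b * (1 + Y))" by simp
  have "real (1 + K * (1 + j * N)) \<le> (1 + real K) * (1 + real j * real N)"
    by (simp add: algebra_simps)
  also have "\<dots> \<le> (3 * ((1 + g)\<^sup>2 * a)) * (200 * (ln1 s * b * (1 + Y)))"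
    using K jN ga by (intro mult_mono) simp_all
  also have "\<dots> = 600 * (1 + g)\<^sup>2 * (1 + Y) * a * b * ln1 s" by (simp add: mult_ac)
  finally show ?thesis using j N N_pos K by blast
qed

section \<open>The ridge loss as weighted least squares\<close>

lemma shifted_mult_mat_vec:
  fixes A :: "real mat"
  assumes "A \<in> carrier_mat d d" "v \<in> carrier_vec d"
  shows "(A + c \<cdot>\<^sub>m 1\<^sub>m d) *\<^sub>v v = A *\<^sub>v v + c \<cdot>\<^sub>v v"
proof -
  have "(c \<cdot>\<^sub>m 1\<^sub>m d) *\<^sub>v v = c \<cdot>\<^sub>v v"
    using assms by (intro eq_vecI) (auto simp: row_one)
  then show ?thesis using assms by (subst add_mult_distrib_mat_vec[where nr=d and nc=d]) auto
qed

definition sample_index :: "nat \<Rightarrow> nat \<Rightarrow> (nat \<times> nat) set" where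
  "sample_index m n = {1..m} \<times> {1..n}"

text \<open>The loss of machine 1 as a weighted average over the samples of all machines.\<close>

definition master_weight :: "nat \<Rightarrow> nat \<times> nat \<Rightarrow> real" where
  "master_weight n p = (if fst p = 1 then 1 / real n else 0)"

lemma sum_master_weight:
  assumes "1 \<le> m"
  shows "(\<Sum>p\<in>sample_index m n. master_weight n p * h p) = (\<Sum>j=1..n. h (1, j)) / real n"
proof -
  have "(\<Sum>p\<in>sample_index m n. master_weight n p * h p) =
      (\<Sum>i=1..m. if i = 1 then (\<Sum>j=1..n. h (i, j) / real n) else 0)"
    unfolding sample_index_def sum.cartesian_product'
    by (intro sum.cong) (auto simp: master_weight_def)
  also have "\<dots> = (\<Sum>j=1..n. h (1, j)) / real n"
    using assms by (simp add: sum_divide_distrib)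
  finally show ?thesis .
qed

lemma average_ridge_loss:
  assumes "1 \<le> m"
  shows "average m (ridge_loss d n lam z) w =
    (\<Sum>p\<in>sample_index m n. 1 / real (m * n) * (label (z p) - w \<bullet> feature d (z p))\<^sup>2) + lam / 2 * (norm2 w)\<^sup>2"
proof -
  have "(\<Sum>p\<in>sample_index m n. 1 / real (m * n) * (label (z p) - w \<bullet> feature d (z p))\<^sup>2) =
    (\<Sum>i=1..m. (\<Sum>j=1..n. (label (z (i, j)) - w \<bullet> feature d (z (i, j)))\<^sup>2) / real n) / real m"
    unfolding sample_index_def sum.cartesian_product'
    by (simp add: sum_divide_distrib mult.commute)
  then show ?thesis using assms by (simp add: average_def ridge_loss_def sum.distrib add_divide_distrib)
qed

text \<open>The deterministic part. The deviation bound says H - \<mu> I <= H1 <= H + \<mu> I, so P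
  = H1 + \<mu> I satisfies H <= P <= H + 2 \<mu> I, and lam I <= H converts the excess into the
  relative factor 1 + 2 \<mu> / lam.\<close>

lemma disco_rounds_ridge_le:
  fixes z :: "nat \<times> nat \<Rightarrow> labelled"
  assumes mn: "1 \<le> m" "1 \<le> n" and lam: "0 < lam" and \<mu>: "0 \<le> \<mu>"
    and x: "\<And>p. p \<in> sample_index m n \<Longrightarrow> norm2 (feature d (z p)) \<le> B"
    and dev: "(\<Sum>q\<in>{..<d} \<times> {..<d}. (\<Sum>p\<in>sample_index m n. (master_weight n p - 1 / real (m * n)) *
        (2 * (feature d (z p) $ fst q * feature d (z p) $ snd q)))\<^sup>2) \<le> \<mu>\<^sup>2"
    and \<epsilon>: "0 < \<epsilon>" and jN: "0 < j" "400 * ((lam + 2 * B\<^sup>2) / lam)\<^sup>2 \<le> 2 ^ j"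
      "0 < N" "2 * sqrt (1 + 2 * \<mu> / lam) \<le> real N"
    and K: "(1 + subopt d (average m (ridge_loss d n lam z)) (init_point d m (ridge_loss d n lam z) ini))\<^sup>2
      * ln1 (1 / \<epsilon>) \<le> real K"
  shows "disco_rounds d m (ridge_loss d n lam z) lam (lam + 2 * B\<^sup>2) \<mu> ini \<epsilon> \<le> enat (1 + K * (1 + j * N))"
proof -
  let ?I = "sample_index m n"
  define X where "X p = feature d (z p)" for p
  define y where "y p = label (z p)" for p
  have X: "X p \<in> carrier_vec d" for p by (simp add: X_def feature_def)
  have XX: "X p \<bullet> X p \<le> B\<^sup>2" if "p \<in> ?I" for p
    using power_mono[OF x[OF that] norm2_nonneg, of 2] by (simp add: X_def norm2_squared)
  interpret G: weighted_least_squares d ?I "\<lambda>_. 1 / real (m * n)" y X lam "B\<^sup>2"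
    using mn lam by unfold_locales (simp_all add: X XX sample_index_def card_cartesian_product)
  interpret G1: weighted_least_squares d ?I "master_weight n" y X lam "B\<^sup>2"
    using mn lam sum_master_weight[OF mn(1), of n "\<lambda>_. 1"]
    by unfold_locales (simp_all add: X XX master_weight_def)
  define H H1 where "H = weighted_gram d ?I (\<lambda>_. 1 / real (m * n)) X lam"
    and "H1 = weighted_gram d ?I (master_weight n) X lam"
  define P where "P = H1 + \<mu> \<cdot>\<^sub>m 1\<^sub>m d"
  have H1: "H1 \<in> carrier_mat d d" by (simp add: H1_def)
  have P_mult: "P *\<^sub>v v = H1 *\<^sub>v v + \<mu> \<cdot>\<^sub>v v" if "v \<in> carrier_vec d" for v
    unfolding P_def by (rule shifted_mult_mat_vec[OF H1 that])
  have P_form: "u \<bullet> (P *\<^sub>v v) = u \<bullet> (H1 *\<^sub>v v) + \<mu> * (u \<bullet> v)"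
    if "u \<in> carrier_vec d" "v \<in> carrier_vec d" for u v
    using that G1.closed[of v] by (simp add: P_mult scalar_prod_vec_simps[where d=d] H1_def)
  have dev': "\<bar>v \<bullet> (H1 *\<^sub>v v) - v \<bullet> (H *\<^sub>v v)\<bar> \<le> \<mu> * (v \<bullet> v)" if v: "v \<in> carrier_vec d" for v
    unfolding H_def H1_def weighted_gram_diff[OF v X]
    by (rule frobenius_bound[OF v _ \<mu>]) (use dev in \<open>simp add: X_def\<close>)
  have quad1: "quadratic_objective d H1 (ridge_loss d n lam z 1)
      (vec d (\<lambda>k. - 2 * (\<Sum>p\<in>?I. master_weight n p * y p * X p $ k))) (\<Sum>p\<in>?I. master_weight n p * (y p)\<^sup>2)"
    unfolding H1_def
    by (rule G1.quadratic)
      (simp only: G1.objective_def sum_master_weight[OF mn(1)] ridge_loss_def X_def y_def)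
  interpret Q: quadratic_objective d H "average m (ridge_loss d n lam z)"
    "vec d (\<lambda>k. - 2 * (\<Sum>p\<in>?I. 1 / real (m * n) * y p * X p $ k))" "\<Sum>p\<in>?I. 1 / real (m * n) * (y p)\<^sup>2"
    unfolding H_def
    by (rule G.quadratic) (simp only: G.objective_def average_ridge_loss[OF mn(1)] X_def y_def)
  have P_spd: "spd_matrix d P"
  proof
    show "P \<in> carrier_mat d d" using H1 by (simp add: P_def)
    show "u \<bullet> (P *\<^sub>v v) = v \<bullet> (P *\<^sub>v u)" if "u \<in> carrier_vec d" "v \<in> carrier_vec d" for u v
      using that G1.sym[of u v] by (simp add: P_form comm_scalar_prod[of u d v] H1_def)
    show "0 < v \<bullet> (P *\<^sub>v v)" if "v \<in> carrier_vec d" "v \<noteq> 0\<^sub>v d" for v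
      using that G1.pos[of v] \<mu> by (simp add: P_form H1_def add_pos_nonneg scalar_prod_self_nonneg)
  qed
  interpret R: disco_run d m "ridge_loss d n lam z" H
    "vec d (\<lambda>k. - 2 * (\<Sum>p\<in>?I. 1 / real (m * n) * y p * X p $ k))" "\<Sum>p\<in>?I. 1 / real (m * n) * (y p)\<^sup>2"
    lam "lam + 2 * B\<^sup>2" P \<mu> "1 + 2 * \<mu> / lam" j N
  proof (intro disco_run.intro disco_run_axioms.intro)
    show "quadratic_objective d H (average m (ridge_loss d n lam z))
      (vec d (\<lambda>k. - 2 * (\<Sum>p\<in>?I. 1 / real (m * n) * y p * X p $ k))) (\<Sum>p\<in>?I. 1 / real (m * n) * (y p)\<^sup>2)"
      by (rule Q.quadratic_objective_axioms)
    show "spd_bounded d H lam (lam + 2 * B\<^sup>2)" unfolding H_def by (rule G.spd_bounded_axioms)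
    show "newton_precond d (ridge_loss d n lam z) \<mu> w = P" if "w \<in> carrier_vec d" for w
      using quadratic_objective.hess_eq[OF quad1 that] by (simp add: newton_precond_def P_def)
    show "v \<bullet> (H *\<^sub>v v) \<le> v \<bullet> (P *\<^sub>v v)" if "v \<in> carrier_vec d" for v
      using dev'[OF that] that by (simp add: P_form)
    show "v \<bullet> (P *\<^sub>v v) \<le> (1 + 2 * \<mu> / lam) * (v \<bullet> (H *\<^sub>v v))" if v: "v \<in> carrier_vec d" for v
    proof -
      have "v \<bullet> (P *\<^sub>v v) \<le> v \<bullet> (H *\<^sub>v v) + 2 * \<mu> / lam * (lam * (v \<bullet> v))"
        using dev'[OF v] v lam by (simp add: P_form)
      also have "\<dots> \<le> v \<bullet> (H *\<^sub>v v) + 2 * \<mu> / lam * (v \<bullet> (H *\<^sub>v v))"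
        unfolding H_def using lam \<mu> by (intro add_left_mono mult_left_mono G.lower v) simp_all
      finally show ?thesis by (simp add: algebra_simps)
    qed
  qed (use P_spd jN in simp_all)
  \<comment> \<open>Either initial point has dimension d by construction; its gap is accounted for
    in K.\<close>
  show ?thesis
    by (rule R.disco_rounds_le[OF _ \<epsilon> K]) (cases ini, simp_all)
qed

section \<open>The high-probability event\<close>

lemma feature_measurable:
  assumes "sets D = sets (labelled_space d)" "k < d"
  shows "(\<lambda>z. feature d z $ k) \<in> borel_measurable D"
proof -
  have "(\<lambda>z. fst z k) \<in> borel_measurable (labelled_space d)"
    using assms(2) unfolding labelled_space_def
    by (intro measurable_compose[OF measurable_fst measurable_component_singleton]) simp
  then have "(\<lambda>z. fst z k) \<in> borel_measurable D"
    using measurable_cong_sets[OF assms(1) refl] by blast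
  then show ?thesis using assms(2) by (simp add: feature_def)
qed

text \<open>The exact value is 1 / n - 1 / (m n); the bound keeps the term contributed by the sample
  size of the master.\<close>

lemma sum_weight_deviation_squared:
  assumes "1 \<le> m" "1 \<le> n"
  shows "(\<Sum>p\<in>sample_index m n. (master_weight n p - 1 / real (m * n))\<^sup>2) \<le> 1 / real n"
proof -
  define c where "c = 1 / real (m * n)"
  have "(master_weight n p - c)\<^sup>2 = master_weight n p * master_weight n p
      - 2 * c * (master_weight n p * 1) + c * c" for p
    by (simp add: power2_eq_square algebra_simps)
  then have "(\<Sum>p\<in>sample_index m n. (master_weight n p - c)\<^sup>2) =
      (\<Sum>p\<in>sample_index m n. master_weight n p * master_weight n p)
      - 2 * c * (\<Sum>p\<in>sample_index m n. master_weight n p * 1) + real (m * n) * (c * c)"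
    by (simp only: sum.distrib sum_subtractf sum_distrib_left[symmetric])
      (simp add: sample_index_def card_cartesian_product)
  also have "\<dots> = 1 / real n - 2 * c + real (m * n) * (c * c)"
    unfolding sum_master_weight[OF assms(1)] using assms by (simp add: master_weight_def)
  also have "\<dots> = 1 / real n - c" using assms by (simp add: c_def)
  finally show ?thesis by (simp add: c_def)
qed

text \<open>\<mu> is calibrated so that \<mu>^2 = 8 \<sigma> ln t with t = m d / \<delta>, and the
  tail becomes exp(1/6) \<delta> / (m d).\<close>

lemma gram_deviation_tail:
  fixes d m n :: nat and B lam L \<mu> \<delta> :: real
  assumes D: "prob_space D" "sets D = sets (labelled_space d)"
    and B: "AE z in D. norm2 (feature d z) \<le> B" "0 \<le> B"
    and dmn: "1 \<le> d" "1 \<le> m" "1 \<le> n" and lam: "0 < lam" and L: "L = lam + 2 * B\<^sup>2"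
    and \<delta>: "0 < \<delta>" "\<delta> < 1"
    and \<mu>: "\<mu> = sqrt (32 * L\<^sup>2 * real d / real n) * sqrt (ln (real m * real d / \<delta>) / real d)"
  shows "measure (iid_samples m n D) {z \<in> space (iid_samples m n D). \<mu>\<^sup>2 \<le>
    (\<Sum>q\<in>{..<d} \<times> {..<d}. (\<Sum>p\<in>sample_index m n. (master_weight n p - 1 / real (m * n)) *
        (2 * (feature d (z p) $ fst q * feature d (z p) $ snd q)))\<^sup>2)} \<le> \<delta>"
proof -
  define t where "t = real m * real d / \<delta>"
  have "1 * 1 \<le> real m * real d" using dmn by (intro mult_mono) simp_all
  then have t: "1 < t" using \<delta> by (simp add: t_def less_divide_eq)
  have L_pos: "0 < L" using lam by (simp add: L add_pos_nonneg)
  have \<mu>2: "\<mu>\<^sup>2 = 32 * L\<^sup>2 * ln t / real n"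
    using t dmn by (simp add: \<mu> t_def[symmetric] power_mult_distrib)
  show ?thesis
  \<comment> \<open>The factor exp(1/6) is absorbed by m d only if m d >= 2. A single machine has
    zero deviation, and \<mu> is positive, so there the event is empty.\<close>
  proof (cases "m = 1")
    case True
    then have "master_weight n p - 1 / real (m * n) = 0" if "p \<in> sample_index m n" for p
      using that by (auto simp: sample_index_def master_weight_def)
    moreover have "0 < \<mu>\<^sup>2" using t L_pos dmn unfolding \<mu>2 by simp
    ultimately show ?thesis using \<delta> by simp
  next
    case False
    interpret bounded_random_vector D "{..<d} \<times> {..<d}"
      "\<lambda>z q. 2 * (feature d z $ fst q * feature d z $ snd q)" L
    proof (intro bounded_random_vector.intro bounded_random_vector_axioms.intro)
      show "(\<lambda>z. 2 * (feature d z $ fst q * feature d z $ snd q)) \<in> borel_measurable D"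
        if "q \<in> {..<d} \<times> {..<d}" for q
        using that feature_measurable[OF D(2)] by (intro borel_measurable_times) auto
      show "AE z in D. (\<Sum>q\<in>{..<d} \<times> {..<d}. (2 * (feature d z $ fst q * feature d z $ snd q))\<^sup>2) \<le> L\<^sup>2"
        using B(1)
      proof eventually_elim
        case (elim z)
        have "feature d z \<in> carrier_vec d" by (simp add: feature_def)
        then have "(\<Sum>q\<in>{..<d} \<times> {..<d}. (2 * (feature d z $ fst q * feature d z $ snd q))\<^sup>2) =
            (2 * (feature d z \<bullet> feature d z))\<^sup>2"
          unfolding power_mult_distrib[of "2::real"] sum_distrib_left[symmetric]
          by (simp only: sum_outer_product_squared)
        also have "\<dots> \<le> L\<^sup>2"
        proof (rule power_mono)
          have "feature d z \<bullet> feature d z \<le> B\<^sup>2"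
            using power_mono[OF elim norm2_nonneg, of 2] by (simp add: norm2_squared)
          then show "2 * (feature d z \<bullet> feature d z) \<le> L" using lam by (simp add: L)
        qed (simp add: scalar_prod_self_nonneg)
        finally show ?case .
      qed
    qed (use D L_pos in simp_all)
    define \<sigma> where "\<sigma> = 4 * L\<^sup>2 / real n"
    have "(\<Sum>p\<in>sample_index m n. master_weight n p * 1) = 1"
      unfolding sum_master_weight[OF dmn(2)] using dmn by simp
    then have "(\<Sum>p\<in>sample_index m n. master_weight n p - 1 / real (m * n)) = 0"
      using dmn by (simp add: sum_subtractf) (simp add: sample_index_def card_cartesian_product)
    moreover have "(\<Sum>p\<in>sample_index m n. (master_weight n p - 1 / real (m * n))\<^sup>2) * (2 * L)\<^sup>2
        \<le> 1 / real n * (2 * L)\<^sup>2"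
      by (intro mult_right_mono sum_weight_deviation_squared dmn) simp
    then have "(\<Sum>p\<in>sample_index m n. (master_weight n p - 1 / real (m * n))\<^sup>2) * (2 * L)\<^sup>2 \<le> \<sigma>"
      by (simp add: \<sigma>_def power_mult_distrib)
    moreover have "0 < \<sigma>" using L_pos dmn by (simp add: \<sigma>_def)
    moreover have "finite (sample_index m n)" by (simp add: sample_index_def)
    ultimately have "measure (iid_samples m n D) {z \<in> space (iid_samples m n D). \<mu>\<^sup>2 \<le>
      (\<Sum>q\<in>{..<d} \<times> {..<d}. (\<Sum>p\<in>sample_index m n. (master_weight n p - 1 / real (m * n)) *
        (2 * (feature d (z p) $ fst q * feature d (z p) $ snd q)))\<^sup>2)} \<le> exp (1 / 6 - \<mu>\<^sup>2 / (8 * \<sigma>))"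
      unfolding iid_samples_def sample_index_def[symmetric] by (intro balanced_sum_tail)
    also have "\<mu>\<^sup>2 / (8 * \<sigma>) = ln t" using L_pos dmn by (simp add: \<mu>2 \<sigma>_def)
    also have "exp (1 / 6 - ln t) = exp (1 / 6) / t" using t by (simp add: exp_diff)
    also have "\<dots> \<le> \<delta>"
    proof -
      have "exp (1 / 6 :: real) \<le> 2" using exp_bound[of "1 / 6 :: real"] by (simp add: power2_eq_square)
      also have "2 * 1 \<le> real m * real d" using dmn False by (intro mult_mono) simp_all
      finally have "exp (1 / 6) \<le> real m * real d" by simp
      moreover have "real m * real d = \<delta> * t" using \<delta> by (simp add: t_def)
      ultimately show ?thesis using t by (simp add: divide_le_eq)
    qed
    finally show ?thesis .
  qed
qed

lemma deviation_measurable: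
  assumes "sets D = sets (labelled_space d)"
  shows "(\<lambda>z. \<Sum>q\<in>{..<d} \<times> {..<d}. (\<Sum>p\<in>sample_index m n. a p *
        (2 * (feature d (z p) $ fst q * feature d (z p) $ snd q)))\<^sup>2) \<in> borel_measurable (iid_samples m n D)"
proof -
  have "(\<lambda>z. feature d (z p) $ k) \<in> borel_measurable (iid_samples m n D)"
    if "p \<in> sample_index m n" "k < d" for p k
    using measurable_compose[OF measurable_component_singleton[OF that(1), of "\<lambda>_. D"]
        feature_measurable[OF assms that(2)]]
    unfolding iid_samples_def sample_index_def .
  then show ?thesis
    by (intro borel_measurable_sum borel_measurable_power borel_measurable_times borel_measurable_const) auto
qed

lemma good_event:
  fixes d m n :: nat and B lam L \<mu> \<delta> :: real
  assumes D: "prob_space D" "sets D = sets (labelled_space d)"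
    and B: "AE z in D. norm2 (feature d z) \<le> B" "0 \<le> B"
    and dmn: "1 \<le> d" "1 \<le> m" "1 \<le> n" and lam: "0 < lam" and L: "L = lam + 2 * B\<^sup>2"
    and \<delta>: "0 < \<delta>" "\<delta> < 1"
    and \<mu>: "\<mu> = sqrt (32 * L\<^sup>2 * real d / real n) * sqrt (ln (real m * real d / \<delta>) / real d)"
  shows "\<exists>E \<in> sets (iid_samples m n D). 1 - \<delta> \<le> measure (iid_samples m n D) E \<and>
    (\<forall>z\<in>E. (\<forall>p\<in>sample_index m n. norm2 (feature d (z p)) \<le> B) \<and>
      (\<Sum>q\<in>{..<d} \<times> {..<d}. (\<Sum>p\<in>sample_index m n. (master_weight n p - 1 / real (m * n)) *
        (2 * (feature d (z p) $ fst q * feature d (z p) $ snd q)))\<^sup>2) \<le> \<mu>\<^sup>2)"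
proof -
  let ?M = "iid_samples m n D"
  define F where "F z = (\<Sum>q\<in>{..<d} \<times> {..<d}. (\<Sum>p\<in>sample_index m n. (master_weight n p - 1 / real (m * n)) *
        (2 * (feature d (z p) $ fst q * feature d (z p) $ snd q)))\<^sup>2)" for z
  interpret M: prob_space ?M unfolding iid_samples_def by (intro prob_space_PiM D)
  have [measurable]: "F \<in> borel_measurable ?M" unfolding F_def by (rule deviation_measurable[OF D(2)])
  \<comment> \<open>Removing a null set, measurable by definition, turns the almost sure bound on
    the features into a pointwise one on a measurable event, as the deterministic part
    requires.\<close>
  obtain N where N: "\<And>z. z \<in> space D - N \<Longrightarrow> norm2 (feature d z) \<le> B" "N \<in> null_sets D"
    using AE_E3[OF B(1)] by blast
  have proj: "(\<lambda>z. z p) \<in> ?M \<rightarrow>\<^sub>M D" if "p \<in> sample_index m n" for p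
    using that unfolding iid_samples_def sample_index_def by (rule measurable_component_singleton)
  have meas: "{z \<in> space ?M. z p \<notin> N} \<in> sets ?M" if "p \<in> sample_index m n" for p
  proof -
    have "{z \<in> space ?M. z p \<notin> N} = (\<lambda>z. z p) -` (space D - N) \<inter> space ?M"
      using measurable_space[OF proj[OF that]] by auto
    then show ?thesis using measurable_sets[OF proj[OF that]] N by auto
  qed
  have fin: "finite (sample_index m n)" by (simp add: sample_index_def)
  \<comment> \<open>The strict inequality makes the first set the exact complement of the tail
    event.\<close>
  define E where "E = {z \<in> space ?M. F z < \<mu>\<^sup>2} \<inter> {z \<in> space ?M. \<forall>p\<in>sample_index m n. z p \<notin> N}"
  have E: "E \<in> sets ?M"
    unfolding E_def by (intro sets.Int sets.sets_Collect_finite_All meas fin) measurable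
  have "AE z in ?M. z p \<notin> N" if "p \<in> sample_index m n" for p
    using that N(2) unfolding iid_samples_def sample_index_def
    by (intro AE_PiM_component D AE_not_in) auto
  then have "AE z in ?M. \<forall>p\<in>sample_index m n. z p \<notin> N"
    using fin by (intro AE_finite_allI) auto
  then have "measure ?M E = measure ?M {z \<in> space ?M. F z < \<mu>\<^sup>2}"
    using E by (intro measure_eq_AE) (auto simp: E_def)
  also have "{z \<in> space ?M. F z < \<mu>\<^sup>2} = space ?M - {z \<in> space ?M. \<mu>\<^sup>2 \<le> F z}" by auto
  also have "measure ?M \<dots> = 1 - measure ?M {z \<in> space ?M. \<mu>\<^sup>2 \<le> F z}"
    by (intro M.prob_compl) measurable
  finally have "1 - \<delta> \<le> measure ?M E"
    using gram_deviation_tail[OF D B dmn lam L \<delta> \<mu>] by (simp add: F_def)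
  moreover have "norm2 (feature d (z p)) \<le> B" if "z \<in> E" "p \<in> sample_index m n" for z p
    using that measurable_space[OF proj[OF that(2)], of z] by (intro N(1)) (auto simp: E_def)
  moreover have "F z \<le> \<mu>\<^sup>2" if "z \<in> E" for z using that by (simp add: E_def)
  ultimately show ?thesis using E unfolding F_def by blast
qed

text \<open>Nonnegative losses make the set of values bounded below, so the real-valued infimum is a
  true lower bound.\<close>

lemma subopt_ridge_nonneg:
  assumes "w \<in> carrier_vec d" "0 < lam"
  shows "0 \<le> subopt d (average m (ridge_loss d n lam z)) w"
proof -
  have "0 \<le> average m (ridge_loss d n lam z) u" for u
    using assms(2) unfolding average_def ridge_loss_def
    by (intro divide_nonneg_nonneg sum_nonneg add_nonneg_nonneg) simp_all
  then have "(INF u\<in>carrier_vec d. average m (ridge_loss d n lam z) u) \<le> average m (ridge_loss d n lam z) w"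
    by (intro cINF_lower assms bdd_belowI2)
  then show ?thesis by (simp add: subopt_def)
qed

theorem corollary4:
  shows "\<exists>C :: real \<Rightarrow> real. mono C \<and>
    (\<forall>(d::nat) (m::nat) (n::nat) (B\<^sub>x::real) (B\<^sub>y::real) (lam::real) (\<delta>::real)
      (X :: real vec set) (Y :: real set) (D :: labelled measure) (ini :: disco_init) (L::real) (\<mu>::real).
      1 \<le> d \<longrightarrow> 1 \<le> m \<longrightarrow> 1 \<le> n \<longrightarrow>
      X \<subseteq> carrier_vec d \<longrightarrow>
      (\<forall>x\<in>X. norm2 x \<le> B\<^sub>x) \<longrightarrow> (\<forall>y\<in>Y. \<bar>y\<bar> \<le> B\<^sub>y) \<longrightarrow>
      prob_space D \<longrightarrow> sets D = sets (labelled_space d) \<longrightarrow>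
      (AE z in D. feature d z \<in> X \<and> label z \<in> Y) \<longrightarrow>
      0 < lam \<longrightarrow> 0 < \<delta> \<longrightarrow> \<delta> < 1 \<longrightarrow>
      L = lam + 2 * B\<^sub>x\<^sup>2 \<longrightarrow>
      \<mu> = sqrt (32 * L\<^sup>2 * real d / real n) * sqrt (ln (real m * real d / \<delta>) / real d) \<longrightarrow>
      valid_init ini \<longrightarrow>
      (\<exists>E \<in> sets (iid_samples m n D).
        measure (iid_samples m n D) E \<ge> 1 - \<delta> \<and>
        (\<forall>z\<in>E. \<forall>\<epsilon>>0.
          let fs = ridge_loss d n lam z;
              gap\<^sub>0 = subopt d (average m fs) (init_point d m fs ini)
          in ereal_of_enat (disco_rounds d m fs lam L \<mu> ini \<epsilon>)
               \<le> ereal (C gap\<^sub>0 * (1 + B\<^sub>x / (sqrt lam * root 4 (real n)))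
                        * ln1 (1 / \<epsilon>) * ln1 (real m * real d / \<delta>) * ln1 (L / lam)))))"
proof -
  \<comment> \<open>600 is the constant of \<open>exists_round_count\<close>. Truncating at 0 makes
    C monotone on all reals and changes nothing for actual gaps.\<close>
  define C :: "real \<Rightarrow> real" where "C g = 600 * (1 + max 0 g)\<^sup>2" for g
  have "mono C"
    unfolding C_def by (intro monoI mult_left_mono power_mono) (auto simp: max_def)
  moreover have "\<exists>E \<in> sets (iid_samples m n D). measure (iid_samples m n D) E \<ge> 1 - \<delta> \<and>
        (\<forall>z\<in>E. \<forall>\<epsilon>>0.
          let fs = ridge_loss d n lam z;
              gap\<^sub>0 = subopt d (average m fs) (init_point d m fs ini)
          in ereal_of_enat (disco_rounds d m fs lam L \<mu> ini \<epsilon>)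
               \<le> ereal (C gap\<^sub>0 * (1 + B\<^sub>x / (sqrt lam * root 4 (real n)))
                        * ln1 (1 / \<epsilon>) * ln1 (real m * real d / \<delta>) * ln1 (L / lam)))"
    if dmn: "1 \<le> d" "1 \<le> m" "1 \<le> n"
      and X: "\<forall>x\<in>X. norm2 x \<le> B\<^sub>x"
      and D: "prob_space D" "sets D = sets (labelled_space d)"
      and XY: "AE z in D. feature d z \<in> X \<and> label z \<in> Y"
      and lam: "0 < lam" and \<delta>: "0 < \<delta>" "\<delta> < 1"
      and L: "L = lam + 2 * B\<^sub>x\<^sup>2"
      and \<mu>: "\<mu> = sqrt (32 * L\<^sup>2 * real d / real n) * sqrt (ln (real m * real d / \<delta>) / real d)"
    for d m n :: nat and B\<^sub>x lam \<delta> L \<mu> :: real and X Y and D :: "labelled measure" and ini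
  proof -
    interpret D: prob_space D by (rule D)
    have B: "AE z in D. norm2 (feature d z) \<le> B\<^sub>x" using XY by eventually_elim (use X in blast)
    \<comment> \<open>A probability space cannot satisfy a false constant statement almost surely,
      so the sign of the radius follows from the existence of data.\<close>
    then have "AE z in D. 0 \<le> B\<^sub>x" by eventually_elim (use norm2_nonneg order_trans in blast)
    then have B0: "0 \<le> B\<^sub>x" by simp
    define t where "t = real m * real d / \<delta>"
    have "1 * 1 \<le> real m * real d" using dmn by (intro mult_mono) simp_all
    then have t: "1 \<le> t" using \<delta> by (simp add: t_def le_divide_eq)
    have \<mu>0: "0 \<le> \<mu>" using t unfolding \<mu> t_def[symmetric] by simp
    define Y' where "Y' = B\<^sub>x / (sqrt lam * root 4 (real n))"
    have Y': "0 \<le> Y'" using B0 lam by (simp add: Y'_def)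
    obtain E where E: "E \<in> sets (iid_samples m n D)" "1 - \<delta> \<le> measure (iid_samples m n D) E"
      and good: "\<And>z p. z \<in> E \<Longrightarrow> p \<in> sample_index m n \<Longrightarrow> norm2 (feature d (z p)) \<le> B\<^sub>x"
        "\<And>z. z \<in> E \<Longrightarrow> (\<Sum>q\<in>{..<d} \<times> {..<d}. (\<Sum>p\<in>sample_index m n. (master_weight n p - 1 / real (m * n)) *
          (2 * (feature d (z p) $ fst q * feature d (z p) $ snd q)))\<^sup>2) \<le> \<mu>\<^sup>2"
      using good_event[OF D B B0 dmn lam L \<delta> \<mu>] by blast
    have "ereal_of_enat (disco_rounds d m (ridge_loss d n lam z) lam L \<mu> ini \<epsilon>)
        \<le> ereal (C g * (1 + Y') * ln1 (1 / \<epsilon>) * ln1 t * ln1 (L / lam))"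
      if z: "z \<in> E" and \<epsilon>: "0 < \<epsilon>"
        and g: "g = subopt d (average m (ridge_loss d n lam z)) (init_point d m (ridge_loss d n lam z) ini)"
      for z \<epsilon> g
    proof -
      have g0: "0 \<le> g" unfolding g by (rule subopt_ridge_nonneg[OF _ lam]) (cases ini, simp_all)
      have "1 \<le> 1 + 2 * \<mu> / lam" "1 \<le> L / lam" using \<mu>0 lam by (simp_all add: L)
      moreover have "sqrt (1 + 2 * \<mu> / lam) \<le> 5 * ln1 t * (1 + Y')"
        unfolding Y'_def by (rule sqrt_condition_bound[OF dmn(1,3) lam B0 L t \<mu>[folded t_def]])
      ultimately obtain j N K where *: "0 < j" "400 * (L / lam)\<^sup>2 \<le> 2 ^ j" "0 < N"
        "2 * sqrt (1 + 2 * \<mu> / lam) \<le> real N" "(1 + g)\<^sup>2 * ln1 (1 / \<epsilon>) \<le> real K"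
        and count: "real (1 + K * (1 + j * N)) \<le> 600 * (1 + g)\<^sup>2 * (1 + Y') * ln1 (1 / \<epsilon>) * ln1 t * ln1 (L / lam)"
        using exists_round_count[of "1 + 2 * \<mu> / lam" "ln1 t" Y' "L / lam" g "ln1 (1 / \<epsilon>)"] g0 Y' ln1_ge(1)
        by blast
      have "disco_rounds d m (ridge_loss d n lam z) lam L \<mu> ini \<epsilon> \<le> enat (1 + K * (1 + j * N))"
        unfolding L
        by (rule disco_rounds_ridge_le[OF dmn(2,3) lam \<mu>0 good[OF z] \<epsilon> *(1) *(2)[unfolded L] *(3,4) *(5)[unfolded g]])
      then have "ereal_of_enat (disco_rounds d m (ridge_loss d n lam z) lam L \<mu> ini \<epsilon>)
          \<le> ereal_of_enat (enat (1 + K * (1 + j * N)))"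
        by (simp only: ereal_of_enat_le_iff)
      also have "\<dots> = ereal (real (1 + K * (1 + j * N)))" by simp
      also have "\<dots> \<le> ereal (C g * (1 + Y') * ln1 (1 / \<epsilon>) * ln1 t * ln1 (L / lam))"
        using count g0 by (simp only: C_def ereal_less_eq max_absorb2)
      finally show ?thesis .
    qed
    then show ?thesis using E unfolding Y'_def t_def Let_def by blast
  qed
  ultimately show ?thesis by blast
qed

end
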